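(* For every $n\in\mathbb{N}$, \begin{align*} W_{15}(n) &= \frac{1}{624}\sigma_3(n) +\frac{3}{208}\sigma_3\left(\frac{n}{3}\right) +\frac{25}{624}\sigma_3\left(\frac{n}{5}\right) +\frac{75}{208}\sigma_3\left(\frac{n}{15}\right) + \frac{5-2n}{120}\sigma(n)+\frac{1-6n}{24}\sigma\left(\frac{n}{15}\right)\\ &\quad -\frac{1}{455}\tau_{4,5}(n)-\frac{9}{455}\tau_{4,5}\left(\frac{n}{3}\right) -\frac{1}{84}\tau_{4, 15; 1}(n)-\frac{1}{80}\tau_{4, 15; 2}(n),\\ W_{3, 5}(n) &= \frac{1}{624}\sigma_3(n)+\frac{3}{208}\sigma_3\left(\frac{n}{3}\right) +\frac{25}{624}\sigma_3\left(\frac{n}{5}\right) +\frac{75}{208}\sigma_3\left(\frac{n}{15}\right) + \frac{5-6n}{120}\sigma\left(\frac{n}{3}\right)+\frac{1-2n}{24}\sigma\left(\frac{n}{5}\right)\\ &\quad - \frac{1}{455}\tau_{4,5}(n) -\frac{9}{455}\tau_{4,5}\left(\frac{n}{3}\right) -\frac{1}{84} \tau_{4, 15; 1}(n)+\frac{1}{80}\tau_{4, 15; 2}(n). \end{align*}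
   Context: For $r\ge 0$ and $n\in\mathbb{N}$, $\sigma_r(n)=\sum_{d\mid n} d^r$, and $\sigma(n)=\sigma_1(n)$. Any arithmetic function evaluated at a non-integer argument (e.g. $\sigma_3(n/3)$ when $3\nmid n$) is taken to be $0$. For $a,b,N\in\mathbb{N}$: $W_N(n)=\sum_{m\in\mathbb{N},\, m<n/N}\sigma(m)\sigma(n-Nm)$ and $W_{a,b}(n)=\sum_{l,m\in\mathbb{N},\ al+bm=n}\sigma(l)\sigma(m)$. Let $q=e^{2\pi i z}$ for $z$ in the upper half-plane, and $\eta(z)=q^{1/24}\prod_{n\ge1}(1-q^n)$ the Dedekind eta function. Define $\Delta_{4,5}(z)=\eta(z)^4\eta(5z)^4=\sum_{n\ge1}\tau_{4,5}(n)q^n$ and $\Delta_{2,15}(z)=\eta(z)\eta(3z)\eta(5z)\eta(15z)$. Define $\Delta_{4,15;1}(z)=\Delta_{4,5}(z)+9\Delta_{4,5}(3z)+5\Delta_{2,15}(z)^2+2\frac{\eta(z)^5\eta(15z)^5}{\eta(3z)\eta(5z)}=\sum_{n\ge1}\tau_{4,15;1}(n)q^n$ and $\Delta_{4,15;2}(z)=\Delta_{4,5}(z)+9\Delta_{4,5}(3z)+7\Delta_{2,15}(z)^2=\sum_{n\ge1}\tau_{4,15;2}(n)q^n$.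
   Formalization: In both formulas the labels of τ_{4,15;1}(n) and τ_{4,15;2}(n) are interchanged (1/84 goes with τ_{4,15;2}, 1/80 with τ_{4,15;1}), because the printed formulas fail at n=2, where W_15(2)=0 but the printed right side is −1/840. *)

theory Defs
  imports "HOL-Analysis.Analysis"
begin

text \<open>
  The natural numbers of the source start at 1; hence the positivity conditions on the
  summation indices below.
\<close>

definition divisor_sigma :: "nat \<Rightarrow> nat \<Rightarrow> nat" where
  "divisor_sigma r n = (\<Sum>d | d dvd n. d ^ r)"

text \<open>The value \<open>f (n / k)\<close>, read as 0 when \<open>n / k\<close> is not an integer.\<close>

definition at_quot :: "(nat \<Rightarrow> 'a::zero) \<Rightarrow> nat \<Rightarrow> nat \<Rightarrow> 'a" where
  "at_quot f n k = (if k dvd n then f (n div k) else 0)"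

definition W1 :: "nat \<Rightarrow> nat \<Rightarrow> nat" where
  "W1 N n = (\<Sum>m | 0 < m \<and> real m < real n / real N. divisor_sigma 1 m * divisor_sigma 1 (n - N * m))"

definition W2 :: "nat \<Rightarrow> nat \<Rightarrow> nat \<Rightarrow> nat" where
  "W2 a b n = (\<Sum>(l, m) | 0 < l \<and> 0 < m \<and> a * l + b * m = n. divisor_sigma 1 l * divisor_sigma 1 m)"

definition q_of :: "complex \<Rightarrow> complex" where
  "q_of z = exp (2 * of_real pi * \<i> * z)"

text \<open>
  The Dedekind eta function; meaningful for \<open>Im z > 0\<close>. The factor \<open>q\<^sup>1\<^sup>/\<^sup>2\<^sup>4\<close> is
  \<open>exp (2 \<pi> i z / 24)\<close>, not a principal power of \<open>q\<close>.
\<close>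

definition dedekind_eta :: "complex \<Rightarrow> complex" where
  "dedekind_eta z = exp (2 * of_real pi * \<i> * z / 24) * (\<Prod>n. 1 - q_of z ^ Suc n)"

definition Delta_4_5 :: "complex \<Rightarrow> complex" where
  "Delta_4_5 z = dedekind_eta z ^ 4 * dedekind_eta (5 * z) ^ 4"

definition Delta_2_15 :: "complex \<Rightarrow> complex" where
  "Delta_2_15 z = dedekind_eta z * dedekind_eta (3 * z) * dedekind_eta (5 * z) * dedekind_eta (15 * z)"

definition Delta_4_15_1 :: "complex \<Rightarrow> complex" where
  "Delta_4_15_1 z = Delta_4_5 z + 9 * Delta_4_5 (3 * z) + 5 * Delta_2_15 z ^ 2
     + 2 * (dedekind_eta z ^ 5 * dedekind_eta (15 * z) ^ 5 / (dedekind_eta (3 * z) * dedekind_eta (5 * z)))"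

definition Delta_4_15_2 :: "complex \<Rightarrow> complex" where
  "Delta_4_15_2 z = Delta_4_5 z + 9 * Delta_4_5 (3 * z) + 7 * Delta_2_15 z ^ 2"

text \<open>
  \<open>has_q_expansion F a\<close>: \<open>F(z) = \<Sum>n\<ge>1. a n q\<^sup>n\<close> on the upper half-plane. The unused value
  \<open>a 0\<close> is set to 0, so that \<open>F\<close> determines \<open>a\<close> as a function on \<open>nat\<close>.
\<close>

definition has_q_expansion :: "(complex \<Rightarrow> complex) \<Rightarrow> (nat \<Rightarrow> complex) \<Rightarrow> bool" where
  "has_q_expansion F a \<longleftrightarrow>
     a 0 = 0 \<and> (\<forall>z. 0 < Im z \<longrightarrow> (\<lambda>n. a n * q_of z ^ n) sums F z)"

definition q_coeff :: "(complex \<Rightarrow> complex) \<Rightarrow> nat \<Rightarrow> complex" where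
  "q_coeff F = (THE a. has_q_expansion F a)"

definition tau_4_5 :: "nat \<Rightarrow> complex" where
  "tau_4_5 = q_coeff Delta_4_5"

text \<open>
  The source attaches the labels 1 and 2 to these two forms as here, but its convolution
  formulas hold only with \<open>tau_4_15_1\<close> and \<open>tau_4_15_2\<close> interchanged: as printed they
  already fail at \<open>n = 2\<close>, where \<open>W1 15 2 = 0\<close> while the printed right-hand side is
  \<open>- 1 / 840\<close>.
\<close>

definition tau_4_15_1 :: "nat \<Rightarrow> complex" where
  "tau_4_15_1 = q_coeff Delta_4_15_1"

definition tau_4_15_2 :: "nat \<Rightarrow> complex" where
  "tau_4_15_2 = q_coeff Delta_4_15_2"

end

(*
  Write theta for q d/dq.  Ramanujan's differential equations for E2, E4, E6 hold at every level d dividing 15,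
  and eta quotients have logarithmic derivatives that are linear in the series d E2(q^d).  The ring of modular
  forms of level 15 and even weight is generated by the weight 2 forms T = eta(z) eta(3z) eta(5z) eta(15z),
  x = (eta(z) eta(15z))^4 / (eta(3z) eta(5z))^2, y = (eta(3z) eta(5z))^4 / (eta(z) eta(15z))^2 and
  w = theta (x/T) / (x/T), with x y = T^2 and one further quadratic relation.  Linear algebra on q-expansions
  suggests expressions for d E2(q^d), d^2 E4(q^d), d^3 E6(q^d) in T, x, y, w and L = theta T / T.  The errors of
  these conjectural relations satisfy a homogeneous linear system of differential equations, because the ideal that
  they generate is closed under theta.  Such a system determines its solutions, except at the resonances
  n = 0, 1, 3, 5, 15, where one coefficient must be inspected; so all errors vanish, and no transformation
  behaviour of modular forms is needed.  The convolution sums are then coefficients of quadratic polynomials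
  in these generators.
*)
theory Submission
  imports Defs "HOL-Complex_Analysis.Complex_Analysis"
begin

section \<open>The differential system of level 15\<close>

text \<open>Why resonances are unavoidable: replacing q by c q in the series of a single level d,
  Euler product included, keeps all axioms of \<open>level15\<close> true, with other errors, and
  changes the series first at q^d. The equations do not know that the four levels share one q, so
  one check per level remains.

  Weight 6 is needed for closure: theta of the weight 2 relations involves E4, theta of the weight 4
  relations involves E6, and theta E6 is again a polynomial in E2, E4, E6. Four weight 2 relations
  have only two independent errors, because \<open>L\<close> and \<open>w\<close> are themselves
  linear combinations of the four \<open>P\<close> series.

  Ramanujan's equations come from counting solutions of a x + b y = n. Analysis enters to tie the
  infinite product to its power series, and to show that the q-expansion of a function on the upper
  half-plane is unique.

  The weight 4 eta quotients are then identified by the same method in miniature: a first-order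
  equation and one coefficient.\<close>

definition theta :: "'a::comm_ring_1 fps \<Rightarrow> 'a fps" where
  "theta f = fps_X * fps_deriv f"

lemma theta_nth: "fps_nth (theta f) n = of_nat n * fps_nth f n"
  by (cases n) (simp_all add: theta_def)

lemma theta_add: "theta (f + g) = theta f + theta g"
  and theta_diff: "theta (f - g) = theta f - theta g"
  and theta_uminus: "theta (- f) = - theta f"
  and theta_mult: "theta (f * g) = theta f * g + f * theta g"
  and theta_of_nat: "theta (of_nat m) = 0"
  and theta_numeral: "theta (numeral k) = 0"
  and theta_1: "theta 1 = 0"
  by (simp_all add: theta_def algebra_simps fps_of_nat[symmetric] numeral_fps_const)

lemma theta_power: "theta (f ^ k) = of_nat k * f ^ (k - 1) * theta f"
  by (simp add: theta_def fps_deriv_power mult_ac fps_of_nat)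

lemmas theta_simps = theta_add theta_diff theta_uminus theta_mult theta_of_nat theta_numeral theta_1
  theta_power

text \<open>
  \<open>a\<close>, \<open>b\<close>, \<open>K\<close>, \<open>e1\<close>, ..., \<open>r15\<close> are the
      errors in the expected relations; \<open>P1\<close>, \<open>S1\<close>, \<open>R1\<close> etc. stand for
  \<open>d E\<^sub>2(q\<^sup>d)\<close>, \<open>d\<^sup>2 E\<^sub>4(q\<^sup>d)\<close>, \<open>d\<^sup>3
      E\<^sub>6(q\<^sup>d)\<close>.
\<close>

locale level15 =
  fixes L w T x y a b K e1 e3 e5 e15 r1 r3 r5 r15
    P1 P3 P5 P15 S1 S3 S5 S15 R1 R3 R5 R15 :: "'a::field_char_0 fps"
  assumes theta_T: "theta T = L * T"
    and theta_x: "theta x = (L + w) * x"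
    and theta_y: "theta y = (L - w) * y"
    and xy: "x * y = T\<^sup>2"
    and K: "K = w^2 + 13*T^2 - 10*T*x + 10*T*y - x^2 - y^2"
    and P1: "P1 = 6*L + 2*w + 2*T + x - 7*y + a"
    and P3: "P3 = 6*L - 2*w + 2*T + 7*x - y + b"
    and P5: "P5 = 6*L - 2*w - 2*T - 7*x + y - b"
    and P15: "P15 = 6*L + 2*w - 2*T - x + 7*y - a"
    and S1: "S1 = 8*w*T - 8*w*x - 112*w*y - 170*T^2 + 68*T*x - 332*T*y + 17*x^2 + 113*y^2 + e1"
    and S3: "S3 = - 8*w*T - 112*w*x - 8*w*y - 170*T^2 + 332*T*x - 68*T*y + 113*x^2 + 17*y^2 + e3"
    and S5: "S5 = 8*w*T + 112*w*x + 8*w*y - 170*T^2 + 332*T*x - 68*T*y + 113*x^2 + 17*y^2 + e5"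
    and S15: "S15 = - 8*w*T + 8*w*x + 112*w*y - 170*T^2 + 68*T*x - 332*T*y + 17*x^2 + 113*y^2 + e15"
    and R1: "R1 = - 380*w*T^2 - 76*w*T*x - 1940*w*T*y - 76*w*x^2 + 1688*w*y^2 - 5236*T^3 - 441*T^2*x
        + 7623*T^2*y + 294*T*x^2 + 9870*T*y^2 + 49*x^3 - 1687*y^3 + r1"
    and R3: "R3 = 380*w*T^2 - 1940*w*T*x - 76*w*T*y - 1688*w*x^2 + 76*w*y^2 - 5236*T^3 - 7623*T^2*x
        + 441*T^2*y + 9870*T*x^2 + 294*T*y^2 + 1687*x^3 - 49*y^3 + r3"
    and R5: "R5 = 380*w*T^2 - 1940*w*T*x - 76*w*T*y - 1688*w*x^2 + 76*w*y^2 + 5236*T^3 + 7623*T^2*x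
        - 441*T^2*y - 9870*T*x^2 - 294*T*y^2 - 1687*x^3 + 49*y^3 + r5"
    and R15: "R15 = - 380*w*T^2 - 76*w*T*x - 1940*w*T*y - 76*w*x^2 + 1688*w*y^2 + 5236*T^3 + 441*T^2*x
        - 7623*T^2*y - 294*T*x^2 - 9870*T*y^2 - 49*x^3 + 1687*y^3 + r15"
    and theta_P1: "12 * theta P1 = P1\<^sup>2 - S1"
    and theta_P3: "12 * theta P3 = P3\<^sup>2 - S3"
    and theta_P5: "12 * theta P5 = P5\<^sup>2 - S5"
    and theta_P15: "12 * theta P15 = P15\<^sup>2 - S15"
    and theta_S1: "3 * theta S1 = P1 * S1 - R1"
    and theta_S3: "3 * theta S3 = P3 * S3 - R3"
    and theta_S5: "3 * theta S5 = P5 * S5 - R5"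
    and theta_S15: "3 * theta S15 = P15 * S15 - R15"
    and theta_R1: "2 * theta R1 = P1 * R1 - S1\<^sup>2"
    and theta_R3: "2 * theta R3 = P3 * R3 - S3\<^sup>2"
    and theta_R5: "2 * theta R5 = P5 * R5 - S5\<^sup>2"
    and theta_R15: "2 * theta R15 = P15 * R15 - S15\<^sup>2"
begin

section \<open>Derivatives of the errors as combinations of the errors\<close>

lemma theta_w: "96 * theta w = 96*L*w + 480*T*x + 480*T*y + 8*T*a - 8*T*b + 96*x^2 + 4*x*a - 28*x*b - 96*y^2
    - 28*y*a + 4*y*b + 2*a^2 - 2*b^2 - e1 + e3 + e5 - e15"
proof -
  \<comment> \<open>In this alternating sum everything but \<open>w\<close> cancels, the errors
    included. The factor 12 of \<open>theta_P1\<close> times 8 gives the 96 that clears denominators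
    throughout.\<close>
  have eq: "8 * w = P1 - P3 - P5 + P15"
    unfolding P1 P3 P5 P15 by simp
  have "96 * theta w = 12 * theta (8 * w)"
    by (simp add: theta_simps)
  also have "\<dots> = 12 * theta P1 - 12 * theta P3 - 12 * theta P5 + 12 * theta P15"
    unfolding eq by (simp add: theta_simps algebra_simps)
  also have "\<dots> = 96*L*w + 480*T*x + 480*T*y + 8*T*a - 8*T*b + 96*x^2 + 4*x*a - 28*x*b - 96*y^2 - 28*y*a
      + 4*y*b + 2*a^2 - 2*b^2 - e1 + e3 + e5 - e15"
    unfolding theta_P1 theta_P3 theta_P5 theta_P15 unfolding P1 P3 P5 P15 S1 S3 S5 S15 by algebra
  finally show ?thesis .
qed

text \<open>Without \<open>a\<close>, \<open>b\<close>, \<open>e1\<close>, ..., \<open>r15\<close>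
  the derivative lies in the ideal generated by \<open>K\<close> and
  \<open>x * y - T\<^sup>2\<close>. The displayed coefficients and the cofactor of
  \<open>x * y - T\<^sup>2\<close> in the proof are a certificate for this; \<open>algebra\<close>
  only has to expand it.\<close>

lemma theta_e1:
  "96 * theta e1 =
      (256*w*T - 256*w*x - 3584*w*y - 5280*T^2 + 2208*T*x - 9504*T*y - 16*T*a + 576*x^2 + 16*x*a + 480*y^2
          + 224*y*a + 32*e1)*a
      + (- 3040*T^2 + 160*T*x - 928*T*y + 16*T*b - 224*x^2 - 16*x*b + 448*y^2 - 224*y*b)*b
      + (192*L + 64*w + 72*T + 24*x - 336*y)*e1
      + (- 8*T + 8*x + 112*y)*e3
      + (- 8*T + 8*x + 112*y)*e5
      + (8*T - 8*x - 112*y)*e15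
      + (- 32)*r1
      + (512*T + 256*x - 17920*y)*K"
    (is "_ = ?rhs")
proof -
  have "96 * theta e1 = 96 * theta (S1 - (8*w*T - 8*w*x - 112*w*y - 170*T^2 + 68*T*x - 332*T*y + 17*x^2 + 113*y^2))"
    by (simp add: S1)
  also have "\<dots> = 32 * (3 * theta S1) - (8*T - 8*x - 112*y) * (96 * theta w)
      - 96 * ((8*w - 340*T + 68*x - 332*y) * theta T + (- 8*w + 68*T + 34*x) * theta x
        + (- 112*w - 332*T + 226*y) * theta y)"
    by (simp add: theta_simps) algebra
  also have "\<dots> = ?rhs + (- 1792*w - 150016*T - 10976*x + 3104*y + 224*a - 3104*b) * (x * y - T\<^sup>2)"
    unfolding theta_w theta_T theta_x theta_y theta_S1 unfolding P1 S1 R1 K by algebra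
  finally show ?thesis
    by (simp add: xy)
qed

lemma theta_r1:
  "96 * theta r1 =
      (- 18240*w*T^2 - 3648*w*T*x - 93120*w*T*y - 3648*w*x^2 + 81024*w*y^2 - 242656*T^3 - 21168*T^2*x
          + 364032*T^2*y + 760*T^2*a + 15024*T*x^2 + 152*T*x*a + 405936*T*y^2 + 3880*T*y*a + 2656*x^3
          + 152*x^2*a - 33712*y^3 - 3376*y^2*a + 48*r1)*a
      + (- 57056*T^3 - 10944*T^2*x + 33264*T^2*y - 760*T^2*b - 2736*T*x^2 - 152*T*x*b + 21264*T*y^2
          - 3880*T*y*b - 2128*x^3 - 152*x^2*b - 6752*y^3 + 3376*y^2*b)*b
      + (- 768*w*T + 768*w*x + 10752*w*y + 15940*T^2 - 6604*T*x + 29932*T*y - 1708*x^2 - 9160*y^2 - 48*e1)*e1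
      + (380*T^2 + 76*T*x + 1940*T*y + 76*x^2 - 1688*y^2)*e3
      + (380*T^2 + 76*T*x + 1940*T*y + 76*x^2 - 1688*y^2)*e5
      + (- 380*T^2 - 76*T*x - 1940*T*y - 76*x^2 + 1688*y^2)*e15
      + (288*L + 96*w + 96*T + 48*x - 336*y)*r1
      + (- 125568*T^2 + 6144*T*x - 286464*T*y + 4224*x^2 - 115968*y^2)*K"
    (is "_ = ?rhs")
proof -
  have "96 * theta r1 = 96 * theta (R1 - (- 380*w*T^2 - 76*w*T*x - 1940*w*T*y - 76*w*x^2 + 1688*w*y^2
      - 5236*T^3 - 441*T^2*x + 7623*T^2*y + 294*T*x^2 + 9870*T*y^2 + 49*x^3 - 1687*y^3))"
    by (simp add: R1)
  also have "\<dots> = 48 * (2 * theta R1) - (- 380*T^2 - 76*T*x - 1940*T*y - 76*x^2 + 1688*y^2) * (96 * theta w)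
      - 96 * ((- 760*w*T - 76*w*x - 1940*w*y - 15708*T^2 - 882*T*x + 15246*T*y + 294*x^2 + 9870*y^2) * theta T
        + (- 76*w*T - 152*w*x - 441*T^2 + 588*T*x + 147*x^2) * theta x
        + (- 1940*w*T + 3376*w*y + 7623*T^2 + 19740*T*y - 5061*y^2) * theta y)"
    by (simp add: theta_simps) algebra
  also have "\<dots> = ?rhs + (- 86016*w^2 + 408576*w*T + 208320*w*x + 167808*w*y + 257472*T^2 + 337056*T*x
      - 2234976*T*y + 5632*T*a - 54016*T*b - 16464*x^2 - 465504*x*y - 2128*x*a + 304*x*b - 80976*y^2
      - 6752*y*a + 47264*y*b) * (x * y - T\<^sup>2)"
    unfolding theta_w theta_T theta_x theta_y theta_R1 unfolding P1 S1 R1 K by algebra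
  finally show ?thesis
    by (simp add: xy)
qed

text \<open>Up to the other errors, \<open>K\<close> has logarithmic derivative
  \<open>2 * L\<close>, like \<open>T\<^sup>2\<close>.\<close>

lemma theta_K:
  "96 * theta K =
      (16*w*T + 8*w*x - 56*w*y + 4*w*a)*a
      + (- 16*w*T - 56*w*x + 8*w*y - 4*w*b)*b
      + (- 2*w)*e1
      + (2*w)*e3
      + (2*w)*e5
      + (- 2*w)*e15
      + (192*L)*K"
    (is "_ = ?rhs")
proof -
  have "96 * theta K = 96 * theta (w^2 + 13*T^2 - 10*T*x + 10*T*y - x^2 - y^2)"
    by (simp add: K)
  also have "\<dots> = 2 * w * (96 * theta w) - 96 * ((2*x + 10*T) * theta x + (10*x - 26*T - 10*y) * theta T
      + (- 10*T + 2*y) * theta y)"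
    by (simp add: theta_simps) algebra
  also have "\<dots> = ?rhs"
    unfolding theta_w theta_T theta_x theta_y unfolding K by algebra
  finally show ?thesis .
qed

text \<open>\<open>P1\<close> and \<open>P15\<close> agree in \<open>L\<close> and \<open>w\<close>
  and contain \<open>a\<close> with opposite signs, so their difference isolates it. The equation
  for \<open>b\<close> is the image under \<open>swap_1_3\<close>.\<close>

lemma theta_a: "24 * theta a = (24*L + 8*w)*a - e1 + e15"
proof -
  have eq: "2 * a = P1 - P15 - 4*T - 2*x + 14*y"
    unfolding P1 P15 by simp
  have "24 * theta a = 12 * theta (2 * a)"
    by (simp add: theta_simps)
  also have "\<dots> = 12 * theta P1 - 12 * theta P15 - 48 * theta T - 24 * theta x + 168 * theta y"
    unfolding eq by (simp add: theta_simps algebra_simps)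
  also have "\<dots> = (24*L + 8*w)*a - e1 + e15"
    unfolding theta_P1 theta_P15 theta_T theta_x theta_y unfolding P1 P15 S1 S15 by algebra
  finally show ?thesis .
qed

text \<open>Two of the Atkin-Lehner involutions; they reduce the four levels to level 1.\<close>

lemma swap_1_15: "level15 L w (- T) (- x) (- y) (- a) (- b) K e15 e5 e3 e1 r15 r5 r3 r1
    P15 P5 P3 P1 S15 S5 S3 S1 R15 R5 R3 R1"
  by unfold_locales
    (simp_all add: theta_T theta_x theta_y xy theta_uminus theta_P1 theta_P3 theta_P5 theta_P15
      theta_S1 theta_S3 theta_S5 theta_S15 theta_R1 theta_R3 theta_R5 theta_R15,
     simp_all add: K P1 P3 P5 P15 S1 S3 S5 S15 R1 R3 R5 R15)

lemma swap_1_3: "level15 L (- w) T (- y) (- x) b a K e3 e1 e15 e5 r3 r1 r15 r5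
    P3 P1 P15 P5 S3 S1 S15 S5 R3 R1 R15 R5"
  by unfold_locales
    (simp_all add: theta_T theta_x theta_y xy mult.commute[of y x] theta_uminus theta_P1 theta_P3 theta_P5 theta_P15
      theta_S1 theta_S3 theta_S5 theta_S15 theta_R1 theta_R3 theta_R5 theta_R15,
     simp_all add: K P1 P3 P5 P15 S1 S3 S5 S15 R1 R3 R5 R15)

end

text \<open>
  The system that the \<open>n\<close>-th coefficients of the errors satisfy when all lower ones vanish. Its
      determinant
  is a multiple of \<open>n\<^sup>7 (n - 1) (n - 3) (n - 5) (n - 15)\<close>.
\<close>

lemma linear_system:
  fixes N a b K e1 e3 e5 e15 r1 r3 r5 r15 :: "'a::field_char_0"
  assumes
        a: "24 * (N * a) = 32*a - e1 + e15"
    and b: "24 * (N * b) = 16*b - e3 + e5"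
    and K: "96 * (N * K) = - 56*a + 8*b + 192*K - 2*e1 + 2*e3 + 2*e5 - 2*e15"
    and e1: "96 * (N * e1) = - 3104*a + 448*b - 17920*K - 80*e1 + 112*e3 + 112*e5 - 112*e15 - 32*r1"
    and e3: "96 * (N * e3) = - 224*a + 320*b - 256*K - 8*e1 + 104*e3 + 8*e5 - 8*e15 - 32*r3"
    and e5: "96 * (N * e5) = 224*a - 832*b + 256*K + 8*e1 - 8*e3 + 152*e5 + 8*e15 - 32*r5"
    and e15: "96 * (N * e15) = - 4064*a - 448*b + 17920*K + 112*e1 - 112*e3 - 112*e5 + 592*e15 - 32*r15"
    and r1: "96 * (N * r1) = 47312*a - 6752*b - 115968*K + 1592*e1 - 1688*e3 - 1688*e5 + 1688*e15 + 48*r1"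
    and r3: "96 * (N * r3) = 2128*a + 992*b + 4224*K + 76*e1 - 940*e3 - 76*e5 + 76*e15 + 144*r3"
    and r5: "96 * (N * r5) = 2128*a - 6304*b + 4224*K + 76*e1 - 76*e3 - 2476*e5 + 76*e15 + 240*r5"
    and r15: "96 * (N * r15) = - 114736*a - 6752*b - 115968*K + 1688*e1 - 1688*e3 - 1688*e5 - 19912*e15 + 720*r15"
    and N: "N \<noteq> 0"
    and a0: "N = 1 \<or> N = 15 \<Longrightarrow> a = 0"
    and b0: "N = 3 \<or> N = 5 \<Longrightarrow> b = 0"
  shows "a = 0 \<and> b = 0 \<and> K = 0 \<and> e1 = 0 \<and> e3 = 0 \<and> e5 = 0 \<and> e15 = 0
    \<and> r1 = 0 \<and> r3 = 0 \<and> r5 = 0 \<and> r15 = 0"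
proof -
  have e15': "e15 = e1 + (24*N - 32)*a"
    using a by algebra
  have e5': "e5 = e3 + (24*N - 16)*b"
    using b by algebra
  have "4*e3 = 4*(e1 + 24*(N - 2)*K + (12*N - 2)*a - (12*N - 6)*b)"
    using K unfolding e15' e5' by algebra
  then have e3': "e3 = e1 + 24*(N - 2)*K + (12*N - 2)*a - (12*N - 6)*b"
    by (metis mult_left_cancel zero_neq_numeral)
  \<comment> \<open>With \<open>e3\<close>, \<open>e5\<close>, \<open>e15\<close> expressed through
    \<open>a\<close>, \<open>b\<close>, \<open>K\<close>, \<open>e1\<close>, eliminating
    \<open>r1\<close> from the equations of \<open>e1\<close> and \<open>r1\<close> leaves a
    multiple of \<open>(N - 1) * B1\<close>; likewise at 3, 5 and 15. Four equations in four
    unknowns remain, each lost at its own resonance.\<close>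
  define B1 where "B1 = 2*a + (336*N + 64)*K - (6*N + 1)*e1"
  define B15 where "B15 = (- 144*N^2 - 168*N + 30)*a + (960 - 336*N)*K - (6*N + 15)*e1"
  define B3 where "B3 = (- 72*N^2 - 24*N + 6)*a + 72*N^2*b + (- 144*N^2 + 240*N + 192)*K - (6*N + 3)*e1"
  define B5 where "B5 = (- 72*N^2 - 48*N + 10)*a - 72*N^2*b + (- 144*N^2 + 144*N + 320)*K - (6*N + 5)*e1"
  have "1536*((N - 1)*B1) = 0"
    using e1 r1 unfolding B1_def e15' e5' e3' by algebra
  then have B1: "N = 1 \<or> B1 = 0" by simp
  have "1536*((N - 3)*B3) = 0"
    using e3 r3 unfolding B3_def e15' e5' e3' by algebra
  then have B3: "N = 3 \<or> B3 = 0" by simp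
  have "1536*((N - 5)*B5) = 0"
    using e5 r5 unfolding B5_def e15' e5' e3' by algebra
  then have B5: "N = 5 \<or> B5 = 0" by simp
  have "1536*((N - 15)*B15) = 0"
    using e15 r15 unfolding B15_def e15' e5' e3' by algebra
  then have B15: "N = 15 \<or> B15 = 0" by simp
  have "a = 0 \<and> b = 0 \<and> K = 0 \<and> e1 = 0"
  proof (cases "N = 1 \<or> N = 15")
    case True
    then have "a = 0"
      by (rule a0)
    have B: "B3 = 0" "B5 = 0"
      using True B3 B5 by auto
    from True have "K = 0 \<and> e1 = 0"
    proof
      assume "N = 1"
      \<comment> \<open>The unknown \<open>b\<close> cancels in \<open>B3 + B5\<close>; this sum and
        \<open>B15\<close> (for \<open>N = 15\<close> below: \<open>B1\<close>) give two independent
        equations in \<open>K\<close> and \<open>e1\<close>.\<close>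
      with B B15 \<open>a = 0\<close> have "624 * K = 21 * e1" "608 * K = 20 * e1"
        unfolding B15_def B3_def B5_def by simp_all algebra
      then show ?thesis
        by algebra
    next
      assume "N = 15"
      with B B1 \<open>a = 0\<close> have "5104 * K = 91 * e1" "- 58528 * K = 188 * e1"
        unfolding B1_def B3_def B5_def by simp_all algebra
      then show ?thesis
        by algebra
    qed
    with \<open>a = 0\<close> B N show ?thesis
      by (simp add: B3_def)
  next
    case False
    then have B: "B1 = 0" "B15 = 0"
      using B1 B15 by auto
    show ?thesis
    proof (cases "N = 3 \<or> N = 5")
      case True
      then have "b = 0"
        by (rule b0)
      \<comment> \<open>Only one of \<open>B3\<close>, \<open>B5\<close> is lost; with
        \<open>b = 0\<close> the other one, \<open>B1\<close> and \<open>B15\<close> determine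
        \<open>a\<close>, \<open>K\<close> and \<open>e1\<close>.\<close>
      moreover have "B3 = 0 \<and> N = 5 \<or> B5 = 0 \<and> N = 3"
        using True B3 B5 by auto
      ultimately show ?thesis
        using B unfolding B1_def B15_def B3_def B5_def by safe algebra+
    next
      case False
      then have B': "B3 = 0" "B5 = 0"
        using B3 B5 by auto
      \<comment> \<open>Cramer's rule for \<open>B1\<close>, \<open>B15\<close> and
        \<open>B3 + B5\<close> in the unknowns \<open>a\<close>, \<open>K\<close>,
        \<open>e1\<close>: up to a numerical factor the determinant is \<open>N^5\<close>.
        Afterwards \<open>B3\<close> yields \<open>b\<close>, whose coefficient there is
        \<open>72*N^2\<close>.\<close>
      have "62208 * (N^5 * a) = - (504*N^2 - 432*N^3) * B1 - (504*N^2 + 432*N^3) * B15 + 1008*N^2 * (B3 + B5)"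
        and "62208 * (N^5 * K) = (144*N^2 + 216*N^3) * (B1 + B15) - (288*N^2 + 216*N^3) * (B3 + B5)"
        and "62208 * (N^5 * e1) = (8208*N^2 + 13824*N^3 - 10368*N^4) * B1 + (8208*N^2 + 12096*N^3) * B15
          - (16416*N^2 + 12096*N^3) * (B3 + B5)"
        unfolding B1_def B15_def B3_def B5_def by algebra+
      with B B' N have "a = 0" "K = 0" "e1 = 0"
        by simp_all
      with B' N show ?thesis
        by (simp add: B3_def)
    qed
  qed
  moreover from this have "e3 = 0" "e5 = 0" "e15 = 0"
    by (simp_all add: e3' e5' e15')
  ultimately show ?thesis
    using e1 e3 e5 e15 by simp
qed

section \<open>Vanishing of the errors, coefficient by coefficient\<close>

lemma fps_mult_nth_lowest:
  fixes f g :: "'a::semiring_0 fps"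
  assumes "\<And>k. k < n \<Longrightarrow> fps_nth g k = 0"
  shows "fps_nth (f * g) n = fps_nth f 0 * fps_nth g n"
proof -
  have "fps_nth (f * g) n = (\<Sum>i\<in>{0..n}. if i = 0 then fps_nth f 0 * fps_nth g n else 0)"
    unfolding fps_mult_nth using assms by (intro sum.cong) auto
  then show ?thesis
    by simp
qed

lemma
  fixes f :: "'a::comm_ring_1 fps"
  shows fps_numeral_mult_nth: "fps_nth (numeral k * f) n = numeral k * fps_nth f n"
    and fps_mult_numeral_nth: "fps_nth (f * numeral k) n = fps_nth f n * numeral k"
  by (simp_all add: numeral_fps_const)

lemma theta_numeral_nth:
  "numeral k * theta f = g \<Longrightarrow> numeral k * (of_nat n * fps_nth f n) = fps_nth g n"
  by (metis fps_numeral_mult_nth theta_nth)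

context level15
begin

text \<open>If all lower coefficients vanish, the n-th coefficient of each differential equation
  sees only the constant terms of the cofactors, given by \<open>init\<close>. This is the situation
  of \<open>linear_system\<close>; \<open>res\<close> supplies the resonant coefficients.\<close>

lemma errors_eq_0:
  assumes init: "fps_nth L 0 = 1" "fps_nth w 0 = 1" "fps_nth T 0 = 0" "fps_nth x 0 = 0" "fps_nth y 0 = 1"
    and init_err: "fps_nth a 0 = 0" "fps_nth b 0 = 0" "fps_nth K 0 = 0"
      "fps_nth e1 0 = 0" "fps_nth e3 0 = 0" "fps_nth e5 0 = 0" "fps_nth e15 0 = 0"
      "fps_nth r1 0 = 0" "fps_nth r3 0 = 0" "fps_nth r5 0 = 0" "fps_nth r15 0 = 0"
    and res: "fps_nth a 1 = 0" "fps_nth a 15 = 0" "fps_nth b 3 = 0" "fps_nth b 5 = 0"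
  shows "a = 0 \<and> b = 0 \<and> K = 0 \<and> e1 = 0 \<and> e3 = 0 \<and> e5 = 0 \<and> e15 = 0"
proof -
  have swap_1_5: "level15 L (- w) (- T) y x (- b) (- a) K e5 e15 e1 e3 r5 r15 r1 r3
      P5 P15 P1 P3 S5 S15 S1 S3 R5 R15 R1 R3"
    using level15.swap_1_15[OF swap_1_3] by simp
  note init_simps = fps_numeral_mult_nth fps_mult_nth_0 fps_power_zeroth init init_err numeral_fps_const
  have "\<forall>f\<in>{a, b, K, e1, e3, e5, e15, r1, r3, r5, r15}. fps_nth f n = 0" for n
  proof (induction n rule: less_induct)
    case (less n)
    show ?case
    proof (cases "n = 0")
      case True
      then show ?thesis
        using init_err by simp
    next
      case False
      have low: "fps_nth a k = 0" "fps_nth b k = 0" "fps_nth K k = 0" "fps_nth e1 k = 0"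
        "fps_nth e3 k = 0" "fps_nth e5 k = 0" "fps_nth e15 k = 0" "fps_nth r1 k = 0"
        "fps_nth r3 k = 0" "fps_nth r5 k = 0" "fps_nth r15 k = 0" if "k < n" for k
        using less.IH[OF that] by simp_all
      \<comment> \<open>The factor \<open>f\<close> may contain errors itself; their constant terms
        are 0 by \<open>init_err\<close>, so products of two errors drop out.\<close>
      have mult_low: "fps_nth (f * g) n = fps_nth f 0 * fps_nth g n"
        if "g \<in> {a, b, K, e1, e3, e5, e15, r1, r3, r5, r15}" for f g
        using that low by (intro fps_mult_nth_lowest) auto
      have a: "24 * (of_nat n * fps_nth a n) = 32 * fps_nth a n - fps_nth e1 n + fps_nth e15 n"
        using theta_numeral_nth[OF theta_a, of n] by (simp add: init_simps mult_low)
      have b: "24 * (of_nat n * fps_nth b n) = 16 * fps_nth b n - fps_nth e3 n + fps_nth e5 n"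
        using theta_numeral_nth[OF level15.theta_a[OF swap_1_3], of n] by (simp add: init_simps mult_low)
      have K: "96 * (of_nat n * fps_nth K n) = - 56 * fps_nth a n + 8 * fps_nth b n + 192 * fps_nth K n
          - 2 * fps_nth e1 n + 2 * fps_nth e3 n + 2 * fps_nth e5 n - 2 * fps_nth e15 n"
        using theta_numeral_nth[OF theta_K, of n] by (simp add: init_simps mult_low)
      have e1: "96 * (of_nat n * fps_nth e1 n) = - 3104 * fps_nth a n + 448 * fps_nth b n
          - 17920 * fps_nth K n - 80 * fps_nth e1 n + 112 * fps_nth e3 n + 112 * fps_nth e5 n
          - 112 * fps_nth e15 n - 32 * fps_nth r1 n"
        using theta_numeral_nth[OF theta_e1, of n] by (simp add: init_simps mult_low)
      have e3: "96 * (of_nat n * fps_nth e3 n) = - 224 * fps_nth a n + 320 * fps_nth b n - 256 * fps_nth K n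
          - 8 * fps_nth e1 n + 104 * fps_nth e3 n + 8 * fps_nth e5 n - 8 * fps_nth e15 n - 32 * fps_nth r3 n"
        using theta_numeral_nth[OF level15.theta_e1[OF swap_1_3], of n] by (simp add: init_simps mult_low)
      have e5: "96 * (of_nat n * fps_nth e5 n) = 224 * fps_nth a n - 832 * fps_nth b n + 256 * fps_nth K n
          + 8 * fps_nth e1 n - 8 * fps_nth e3 n + 152 * fps_nth e5 n + 8 * fps_nth e15 n - 32 * fps_nth r5 n"
        using theta_numeral_nth[OF level15.theta_e1[OF swap_1_5], of n] by (simp add: init_simps mult_low)
      have e15: "96 * (of_nat n * fps_nth e15 n) = - 4064 * fps_nth a n - 448 * fps_nth b n
          + 17920 * fps_nth K n + 112 * fps_nth e1 n - 112 * fps_nth e3 n - 112 * fps_nth e5 n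
          + 592 * fps_nth e15 n - 32 * fps_nth r15 n"
        using theta_numeral_nth[OF level15.theta_e1[OF swap_1_15], of n] by (simp add: init_simps mult_low)
      have r1: "96 * (of_nat n * fps_nth r1 n) = 47312 * fps_nth a n - 6752 * fps_nth b n
          - 115968 * fps_nth K n + 1592 * fps_nth e1 n - 1688 * fps_nth e3 n - 1688 * fps_nth e5 n
          + 1688 * fps_nth e15 n + 48 * fps_nth r1 n"
        using theta_numeral_nth[OF theta_r1, of n] by (simp add: init_simps mult_low)
      have r3: "96 * (of_nat n * fps_nth r3 n) = 2128 * fps_nth a n + 992 * fps_nth b n + 4224 * fps_nth K n
          + 76 * fps_nth e1 n - 940 * fps_nth e3 n - 76 * fps_nth e5 n + 76 * fps_nth e15 n + 144 * fps_nth r3 n"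
        using theta_numeral_nth[OF level15.theta_r1[OF swap_1_3], of n] by (simp add: init_simps mult_low)
      have r5: "96 * (of_nat n * fps_nth r5 n) = 2128 * fps_nth a n - 6304 * fps_nth b n + 4224 * fps_nth K n
          + 76 * fps_nth e1 n - 76 * fps_nth e3 n - 2476 * fps_nth e5 n + 76 * fps_nth e15 n + 240 * fps_nth r5 n"
        using theta_numeral_nth[OF level15.theta_r1[OF swap_1_5], of n] by (simp add: init_simps mult_low)
      have r15: "96 * (of_nat n * fps_nth r15 n) = - 114736 * fps_nth a n - 6752 * fps_nth b n
          - 115968 * fps_nth K n + 1688 * fps_nth e1 n - 1688 * fps_nth e3 n - 1688 * fps_nth e5 n
          - 19912 * fps_nth e15 n + 720 * fps_nth r15 n"
        using theta_numeral_nth[OF level15.theta_r1[OF swap_1_15], of n] by (simp add: init_simps mult_low)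
      have "of_nat n = (1::'a) \<or> of_nat n = (15::'a) \<Longrightarrow> fps_nth a n = 0"
        and "of_nat n = (3::'a) \<or> of_nat n = (5::'a) \<Longrightarrow> fps_nth b n = 0"
        using res by (metis of_nat_1 of_nat_eq_iff of_nat_numeral)+
      with linear_system[OF a b K e1 e3 e5 e15 r1 r3 r5 r15] False show ?thesis
        by simp
    qed
  qed
  then show ?thesis
    by (simp add: fps_eq_iff)
qed

end

section \<open>Ramanujan's differential equations\<close>

lemma dvd_div_pos: "d dvd n \<Longrightarrow> 0 < n \<Longrightarrow> 0 < n div d" for d n :: nat
  by (auto elim!: dvdE)

text \<open>A divisor \<open>a\<close> of some \<open>m\<close> and a divisor \<open>b\<close> of
  \<open>n - m\<close>, with their cofactors: the index set of a product of two divisor sum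
  series.\<close>

definition quads :: "nat \<Rightarrow> (nat \<times> nat \<times> nat \<times> nat) set" where
  "quads n = {(a, b, x, y). 0 < a \<and> 0 < b \<and> 0 < x \<and> 0 < y \<and> a * x + b * y = n}"

lemma finite_quads: "finite (quads n)"
proof (rule finite_subset)
  show "quads n \<subseteq> {..n} \<times> {..n} \<times> {..n} \<times> {..n}"
  proof safe
    fix a b x y assume "(a, b, x, y) \<in> quads n"
    then have q: "0 < a" "0 < b" "0 < x" "0 < y" "a * x + b * y = n"
      by (auto simp: quads_def)
    have "a * x \<le> n" "b * y \<le> n"
      using q(5) by auto
    moreover have "a \<le> a * x" "b \<le> b * y" "x \<le> a * x" "y \<le> b * y"
      using q by auto
    ultimately show "a \<le> n" "b \<le> n" "x \<le> n" "y \<le> n"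
      by (meson order_trans)+
  qed
qed auto

text \<open>
  Skoruppa's argument: \<open>(a, b, x, y) \<mapsto> (a, a + b, x
      - y, y)\<close> maps the solutions of \<open>a x + b y = n\<close> with \<open>y < x\<close>
  to those with \<open>a < b\<close>.
\<close>

lemma sum_quads_diff:
  fixes g h :: "nat \<Rightarrow> nat \<Rightarrow> 'a::ab_group_add"
  assumes h1: "\<And>a b. h a (a + b) = g a b" and h2: "\<And>a b. h (a + b) b = g a b"
  shows "(\<Sum>(a, b, x, y)\<in>quads n. g a b - h a b) =
    (\<Sum>(a, b, x, y) | (a, b, x, y) \<in> quads n \<and> x = y. g a b)
    - (\<Sum>(a, b, x, y) | (a, b, x, y) \<in> quads n \<and> a = b. h a b)"
proof -
  note fin = finite_subset[OF _ finite_quads[of n]]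
  have split_g: "quads n = {(a, b, x, y). (a, b, x, y) \<in> quads n \<and> x = y}
      \<union> ({(a, b, x, y). (a, b, x, y) \<in> quads n \<and> y < x} \<union> {(a, b, x, y). (a, b, x, y)
          \<in> quads n \<and> x < y})"
    and split_h: "quads n = {(a, b, x, y). (a, b, x, y) \<in> quads n \<and> a = b}
      \<union> ({(a, b, x, y). (a, b, x, y) \<in> quads n \<and> a < b} \<union> {(a, b, x, y). (a, b, x, y)
          \<in> quads n \<and> b < a})"
    by (auto simp: not_less le_less)
  have "(\<Sum>(a, b, x, y)\<in>quads n. g a b) = (\<Sum>(a, b, x, y) | (a, b, x, y) \<in> quads n \<and> x =
      y. g a b)
     + ((\<Sum>(a, b, x, y) | (a, b, x, y) \<in> quads n \<and> y < x. g a b)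
     + (\<Sum>(a, b, x, y) | (a, b, x, y) \<in> quads n \<and> x < y. g a b))"
    by (subst split_g, subst sum.union_disjoint, (rule fin; auto), (rule fin; auto), force,
        subst sum.union_disjoint, (rule fin; auto), (rule fin; auto)) auto
  moreover have "(\<Sum>(a, b, x, y)\<in>quads n. h a b) = (\<Sum>(a, b, x, y) | (a, b, x, y) \<in> quads n
      \<and> a = b. h a b)
     + ((\<Sum>(a, b, x, y) | (a, b, x, y) \<in> quads n \<and> a < b. h a b)
     + (\<Sum>(a, b, x, y) | (a, b, x, y) \<in> quads n \<and> b < a. h a b))"
    by (subst split_h, subst sum.union_disjoint, (rule fin; auto), (rule fin; auto), force,
        subst sum.union_disjoint, (rule fin; auto), (rule fin; auto)) auto
  moreover have "(\<Sum>(a, b, x, y) | (a, b, x, y) \<in> quads n \<and> y < x. g a b)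
      = (\<Sum>(a, b, x, y) | (a, b, x, y) \<in> quads n \<and> a < b. h a b)"
    by (rule sum.reindex_bij_witness[where i = "\<lambda>(a, b, x, y). (a, b - a, x + y, y)"
          and j = "\<lambda>(a, b, x, y). (a, a + b, x - y, y)"])
       (auto simp: quads_def h1 algebra_simps diff_mult_distrib diff_mult_distrib2 mult_le_mono trans_le_add1)
  moreover have "(\<Sum>(a, b, x, y) | (a, b, x, y) \<in> quads n \<and> x < y. g a b)
      = (\<Sum>(a, b, x, y) | (a, b, x, y) \<in> quads n \<and> b < a. h a b)"
    by (rule sum.reindex_bij_witness[where i = "\<lambda>(a, b, x, y). (a - b, b, x, x + y)"
          and j = "\<lambda>(a, b, x, y). (a + b, b, x, y - x)"])
       (auto simp: quads_def h2 algebra_simps diff_mult_distrib diff_mult_distrib2 mult_le_mono trans_le_add1)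
  ultimately show ?thesis
    by (simp add: case_prod_unfold sum_subtractf)
qed

text \<open>Here \<open>(a + b) * x = n\<close>, so \<open>d = a + b\<close> runs through the
  divisors of \<open>n\<close>, and \<open>x\<close> is determined by \<open>d\<close>.\<close>

lemma sum_quads_x_eq_y:
  fixes g :: "nat \<Rightarrow> nat \<Rightarrow> 'a::comm_monoid_add"
  assumes "0 < n"
  shows "(\<Sum>(a, b, x, y) | (a, b, x, y) \<in> quads n \<and> x = y. g a b)
    = (\<Sum>d | d dvd n. \<Sum>a\<in>{1..<d}. g a (d - a))"
proof -
  have "(\<Sum>d | d dvd n. \<Sum>a\<in>{1..<d}. g a (d - a))
      = (\<Sum>(d, a)\<in>(SIGMA d:{d. d dvd n}. {1..<d}). g a (d - a))"
    using assms by (intro sum.Sigma) auto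
  also have "\<dots> = (\<Sum>(a, b, x, y) | (a, b, x, y) \<in> quads n \<and> x = y. g a b)"
    using assms
    by (intro sum.reindex_bij_witness[where j = "\<lambda>(d, a). (a, d - a, n div d, n div d)"
          and i = "\<lambda>(a, b, x, y). (a + b, a)"])
       (auto simp: quads_def add_mult_distrib[symmetric] dvd_div_pos)
  finally show ?thesis ..
qed

text \<open>Here \<open>a * (x + y) = n\<close>: the divisor \<open>d = a\<close> occurs once for
  each way to split \<open>n div d\<close> into two positive parts.\<close>

lemma sum_quads_a_eq_b:
  fixes h :: "nat \<Rightarrow> nat \<Rightarrow> 'a::comm_ring_1"
  assumes "0 < n"
  shows "(\<Sum>(a, b, x, y) | (a, b, x, y) \<in> quads n \<and> a = b. h a b)
    = (\<Sum>d | d dvd n. (of_nat (n div d) - 1) * h d d)"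
proof -
  have "(\<Sum>d | d dvd n. (of_nat (n div d) - 1) * h d d) = (\<Sum>d | d dvd n. \<Sum>x\<in>{1..<n div d}. h d d)"
    using assms by (intro sum.cong) (auto simp: of_nat_diff Suc_le_eq dvd_div_pos)
  also have "\<dots> = (\<Sum>(d, x)\<in>(SIGMA d:{d. d dvd n}. {1..<n div d}). h d d)"
    using assms by (intro sum.Sigma) auto
  also have "\<dots> = (\<Sum>(a, b, x, y) | (a, b, x, y) \<in> quads n \<and> a = b. h a b)"
    using assms
    by (intro sum.reindex_bij_witness[where j = "\<lambda>(d, x). (d, d, x, n div d - x)"
          and i = "\<lambda>(a, b, x, y). (a, x)"])
       (auto simp: quads_def add_mult_distrib2[symmetric] dvd_pos_nat)
  finally show ?thesis ..
qed

definition sigma_fps :: "nat \<Rightarrow> 'a::comm_ring_1 fps" where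
  "sigma_fps k = Abs_fps (\<lambda>n. of_nat (divisor_sigma k n))"

lemma sigma_fps_nth: "fps_nth (sigma_fps k) n = of_nat (divisor_sigma k n)"
  by (simp add: sigma_fps_def)

text \<open>Every number divides 0, and a sum over an infinite set is 0 by convention; so
  \<open>sigma_fps\<close> has no constant term.\<close>

lemma divisor_sigma_0: "divisor_sigma k 0 = 0"
  by (simp add: divisor_sigma_def)

lemma sigma_fps_mult_nth:
  "fps_nth (sigma_fps i * sigma_fps j) n =
    (\<Sum>(a, b, x, y)\<in>quads n. of_nat a ^ i * of_nat b ^ j :: 'a::comm_ring_1)"
proof -
  have "fps_nth (sigma_fps i * sigma_fps j) n
      = (\<Sum>m\<in>{0<..<n}. of_nat (divisor_sigma i m) * of_nat (divisor_sigma j (n - m)))"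
    unfolding fps_mult_nth sigma_fps_nth
    by (rule sum.mono_neutral_right) (auto simp: divisor_sigma_0)
  also have "\<dots> = (\<Sum>m\<in>{0<..<n}. \<Sum>(a, b)\<in>{a. a dvd m} \<times> {b. b dvd n
      - m}. of_nat a ^ i * of_nat b ^ j)"
    by (intro sum.cong refl) (simp add: divisor_sigma_def sum_product sum.cartesian_product)
  also have "\<dots> = (\<Sum>(m, a, b)\<in>(SIGMA m:{0<..<n}. {a. a dvd m} \<times> {b. b dvd n
      - m}). of_nat a ^ i * of_nat b ^ j)"
    by (subst sum.Sigma) (auto simp: case_prod_unfold)
  also have "\<dots> = (\<Sum>(a, b, x, y)\<in>quads n. of_nat a ^ i * of_nat b ^ j)"
    by (intro sum.reindex_bij_witness[where j = "\<lambda>(m, a, b). (a, b, m div a, (n - m) div b)"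
          and i = "\<lambda>(a, b, x, y). (a * x, a, b)"])
       (auto simp: quads_def dvd_div_pos intro: dvd_pos_nat[rotated])
  finally show ?thesis .
qed

text \<open>
  Forms invariant under \<open>(a, b) \<mapsto> (- b, a
      + b)\<close>; the coefficients 42 and 747 make \<open>\<sigma>\<^sub>7\<close> disappear
  from the resulting identity.
\<close>

definition form2 :: "'a::field_char_0 \<Rightarrow> 'a \<Rightarrow> 'a" where
  "form2 a b = a^2 + a*b + b^2"

definition form4 :: "'a::field_char_0 \<Rightarrow> 'a \<Rightarrow> 'a" where
  "form4 a b = (a^2 + a*b + b^2)^2"

definition form6 :: "'a::field_char_0 \<Rightarrow> 'a \<Rightarrow> 'a" where
  "form6 a b = 42*(a^2 + a*b + b^2)^3 - 747*(a*b*(a + b))^2"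

lemma sum_closed_form:
  fixes f F :: "nat \<Rightarrow> 'a::field_char_0"
  assumes "F 0 = 0" and "\<And>m. F (Suc m) = F m + c * f (Suc m)"
  shows "c * (\<Sum>a\<in>{1..<Suc m}. f a) = F m"
  by (induction m) (simp_all add: assms distrib_left)

lemma sum_form2:
  assumes "0 < d"
  shows "6 * (\<Sum>a\<in>{1..<d}. form2 (of_nat a) (of_nat (d - a))) =
    (let D = of_nat d :: 'a::field_char_0 in 5*D^3 - 6*D^2 + D)"
proof -
  obtain k where k: "d = Suc k"
    using assms by (cases d) auto
  define D where "D = (of_nat d :: 'a)"
  \<comment> \<open>Six times the sum over \<open>1 \<le> a \<le> M\<close> with \<open>D\<close>
    held fixed, as a polynomial in \<open>M\<close>; the claim is its value at
    \<open>M = D - 1\<close>.\<close>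
  define F where "F = (\<lambda>M. 2*M^3 - 3*M^2*D + 3*M^2 + 6*M*D^2 - 3*M*D + M)"
  have step: "F (M + 1) = F M + 6 * form2 (M + 1) (D - (M + 1))" for M
    unfolding F_def form2_def by algebra
  have "6 * (\<Sum>a\<in>{1..<Suc k}. form2 (of_nat a) (D - of_nat a)) = F (of_nat k)"
  proof (rule sum_closed_form[where F = "\<lambda>m. F (of_nat m)"])
    show "F (of_nat (Suc m)) = F (of_nat m) + 6 * form2 (of_nat (Suc m)) (D - of_nat (Suc m))" for m
      using step[of "of_nat m"] by (simp add: add.commute)
  qed (simp add: F_def)
  moreover have "(\<Sum>a\<in>{1..<d}. form2 (of_nat a) (of_nat (d
      - a))) = (\<Sum>a\<in>{1..<Suc k}. form2 (of_nat a) (D - of_nat a))"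
    unfolding k[symmetric] by (intro sum.cong) (simp_all add: D_def of_nat_diff)
  moreover have "of_nat k = D - 1"
    by (simp add: D_def k)
  moreover have "F (D - 1) = 5*D^3 - 6*D^2 + D"
    unfolding F_def by algebra
  ultimately show ?thesis
    by (simp add: D_def Let_def)
qed

lemma sum_form4:
  assumes "0 < d"
  shows "30 * (\<Sum>a\<in>{1..<d}. form4 (of_nat a) (of_nat (d - a))) =
    (let D = of_nat d :: 'a::field_char_0 in 21*D^5 - 30*D^4 + 10*D^3 - D)"
proof -
  obtain k where k: "d = Suc k"
    using assms by (cases d) auto
  define D where "D = (of_nat d :: 'a)"
  define F where "F = (\<lambda>M. 6*M^5 - 15*M^4*D + 15*M^4 + 30*M^3*D^2 - 30*M^3*D + 10*M^3 - 30*M^2*D^3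
      + 45*M^2*D^2 - 15*M^2*D + 30*M*D^4 - 30*M*D^3 + 15*M*D^2 - M)"
  have step: "F (M + 1) = F M + 30 * form4 (M + 1) (D - (M + 1))" for M
    unfolding F_def form4_def by algebra
  have "30 * (\<Sum>a\<in>{1..<Suc k}. form4 (of_nat a) (D - of_nat a)) = F (of_nat k)"
  proof (rule sum_closed_form[where F = "\<lambda>m. F (of_nat m)"])
    show "F (of_nat (Suc m)) = F (of_nat m) + 30 * form4 (of_nat (Suc m)) (D - of_nat (Suc m))" for m
      using step[of "of_nat m"] by (simp add: add.commute)
  qed (simp add: F_def)
  moreover have "(\<Sum>a\<in>{1..<d}. form4 (of_nat a) (of_nat (d
      - a))) = (\<Sum>a\<in>{1..<Suc k}. form4 (of_nat a) (D - of_nat a))"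
    unfolding k[symmetric] by (intro sum.cong) (simp_all add: D_def of_nat_diff)
  moreover have "of_nat k = D - 1"
    by (simp add: D_def k)
  moreover have "F (D - 1) = 21*D^5 - 30*D^4 + 10*D^3 - D"
    unfolding F_def by algebra
  ultimately show ?thesis
    by (simp add: D_def Let_def)
qed

lemma sum_form6:
  assumes "0 < d"
  shows "(\<Sum>a\<in>{1..<d}. form6 (of_nat a) (of_nat (d - a))) =
    (let D = of_nat d :: 'a::field_char_0 in 21*D^5 - 42*D^6 + 20*D^3 + D)"
proof -
  obtain k where k: "d = Suc k"
    using assms by (cases d) auto
  define D where "D = (of_nat d :: 'a)"
  \<comment> \<open>Twice the sum, to keep the coefficients integral.\<close>
  define F where "F = (\<lambda>M. 12*M^7 - 42*M^6*D + 42*M^6 - 198*M^5*D^2 - 126*M^5*D + 42*M^5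
      + 600*M^4*D^3 - 495*M^4*D^2 - 105*M^4*D - 330*M^3*D^4 + 1200*M^3*D^3 - 330*M^3*D^2 - 14*M^3
      - 126*M^2*D^5 - 495*M^2*D^4 + 600*M^2*D^3 + 21*M^2*D + 84*M*D^6 - 126*M*D^5 - 165*M*D^4 + 33*M*D^2 + 2*M)"
  have step: "F (M + 1) = F M + 2 * form6 (M + 1) (D - (M + 1))" for M
    unfolding F_def form6_def by algebra
  have "2 * (\<Sum>a\<in>{1..<Suc k}. form6 (of_nat a) (D - of_nat a)) = F (of_nat k)"
  proof (rule sum_closed_form[where F = "\<lambda>m. F (of_nat m)"])
    show "F (of_nat (Suc m)) = F (of_nat m) + 2 * form6 (of_nat (Suc m)) (D - of_nat (Suc m))" for m
      using step[of "of_nat m"] by (simp add: add.commute)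
  qed (simp add: F_def)
  moreover have "(\<Sum>a\<in>{1..<d}. form6 (of_nat a) (of_nat (d
      - a))) = (\<Sum>a\<in>{1..<Suc k}. form6 (of_nat a) (D - of_nat a))"
    unfolding k[symmetric] by (intro sum.cong) (simp_all add: D_def of_nat_diff)
  moreover have "of_nat k = D - 1"
    by (simp add: D_def k)
  moreover have "F (D - 1) = 2*(21*D^5 - 42*D^6 + 20*D^3 + D)"
    unfolding F_def by algebra
  ultimately have "2 * (\<Sum>a\<in>{1..<d}. form6 (of_nat a) (of_nat (d - a))) = 2 * (21*D^5 - 42*D^6 + 20*D^3 + D)"
    by simp
  then show ?thesis
    unfolding Let_def D_def by (metis mult_left_cancel zero_neq_numeral)
qed

section \<open>Convolution identities of divisor sums, equivalent to Ramanujan's equations\<close>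

lemma sum_quads_diff_divisors:
  fixes g h :: "nat \<Rightarrow> nat \<Rightarrow> 'a::comm_ring_1"
  assumes "\<And>a b. h a (a + b) = g a b" "\<And>a b. h (a + b) b = g a b"
  shows "(\<Sum>(a, b, x, y)\<in>quads n. g a b - h a b) =
    (\<Sum>d | d dvd n. (\<Sum>a\<in>{1..<d}. g a (d - a)) - (of_nat (n div d) - 1) * h d d)"
proof (cases "n = 0")
  case True
  moreover have "quads 0 = {}"
    by (auto simp: quads_def)
  ultimately show ?thesis
    by simp
next
  case False
  with sum_quads_diff[OF assms] show ?thesis
    by (simp add: sum_quads_x_eq_y sum_quads_a_eq_b sum_subtractf)
qed

text \<open>With \<open>h\<close> equal to \<open>g\<close> after negating \<open>b\<close>,
  invariance of the form gives the hypotheses of \<open>sum_quads_diff\<close>, while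
  \<open>g - h\<close> keeps just the monomials odd in \<open>b\<close>, here a multiple of
  \<open>a * b\<close>. Summed over \<open>quads\<close> these are convolutions of divisor sums. The
  next two identities follow the same pattern.\<close>

lemma sigma_1_1: "12 * (sigma_fps 1 * sigma_fps 1) = (5 * sigma_fps 3 + sigma_fps 1
    - 6 * theta (sigma_fps 1) :: 'a::field_char_0 fps)" (is "?lhs = ?rhs")
proof (rule fps_ext)
  fix n
  define g h where "g a b = form2 (of_nat a) (of_nat b :: 'a)"
    and "h a b = form2 (of_nat a) (- of_nat b :: 'a)" for a b
  have gh: "g a b - h a b = 2 * (of_nat a ^ 1 * of_nat b ^ 1)" for a b
    unfolding g_def h_def form2_def by algebra
  \<comment> \<open>The even power of \<open>D\<close> in the closed form cancels against
    \<open>h d d\<close>, and \<open>n div d\<close> times \<open>h d d\<close> becomes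
    \<open>n * D\<close>, the source of the \<open>theta\<close> term.\<close>
  have summand: "6 * ((\<Sum>a\<in>{1..<d}. g a (d - a)) - (of_nat (n div d) - 1) * h d d)
      = (let D = of_nat d in 5*D^3 + D - 6 * of_nat n*D)" if d: "d dvd n" "0 < n" for d
  proof -
    have "0 < d"
      using d by (rule dvd_pos_nat[rotated])
    have h: "h d d = of_nat d ^ 2"
      unfolding h_def form2_def by algebra
    have "of_nat n = (of_nat (n div d) * of_nat d :: 'a)"
      using d by (simp flip: of_nat_mult)
    with sum_form2[OF \<open>0 < d\<close>, where 'a = 'a] show ?thesis
      unfolding right_diff_distrib g_def h Let_def by algebra
  qed
  have "(\<Sum>(a, b, x, y)\<in>quads n. g a b - h a b) = 2 * fps_nth (sigma_fps 1 * sigma_fps 1) n"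
    unfolding gh sigma_fps_mult_nth
    by (simp add: sum_distrib_left sum.distrib sum_subtractf case_prod_unfold)
  then have "fps_nth ?lhs n = 6 * (\<Sum>(a, b, x, y)\<in>quads n. g a b - h a b)"
    by (simp add: fps_numeral_mult_nth fps_mult_numeral_nth mult.commute)
  also have "\<dots> = (\<Sum>d | d dvd n. 6 * ((\<Sum>a\<in>{1..<d}. g a (d - a)) - (of_nat (n div d) - 1) * h d d))"
    by (subst sum_quads_diff_divisors, (simp_all add: g_def h_def form2_def sum_distrib_left)[3]) algebra+
  also have "\<dots> = fps_nth ?rhs n"
  proof (cases "n = 0")
    case False
    then have "(\<Sum>d | d dvd n. 6 * ((\<Sum>a\<in>{1..<d}. g a (d - a)) - (of_nat (n div d) - 1) * h d d))
        = (\<Sum>d | d dvd n. let D = of_nat d in 5*D^3 + D - 6 * of_nat n*D)"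
      by (intro sum.cong) (simp_all only: summand mem_Collect_eq not_gr_zero[symmetric] not_not)
    also have "\<dots> = fps_nth ?rhs n"
      by (simp add: Let_def fps_numeral_mult_nth fps_mult_numeral_nth sigma_fps_nth theta_nth divisor_sigma_def
          sum.distrib
          sum_subtractf sum_distrib_left algebra_simps)
    finally show ?thesis .
  qed (simp add: fps_numeral_mult_nth fps_mult_numeral_nth sigma_fps_nth theta_nth divisor_sigma_0)
  finally show "fps_nth ?lhs n = fps_nth ?rhs n" .
qed

lemma sigma_1_3: "240 * (sigma_fps 1 * sigma_fps 3) = (21 * sigma_fps 5 + 10 * sigma_fps 3 - sigma_fps 1
    - 30 * theta (sigma_fps 3) :: 'a::field_char_0 fps)" (is "?lhs = ?rhs")
proof (rule fps_ext)
  fix n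
  define g h where "g a b = form4 (of_nat a) (of_nat b :: 'a)"
    and "h a b = form4 (of_nat a) (- of_nat b :: 'a)" for a b
  have gh: "g a b - h a b = 4 * (of_nat a ^ 1 * of_nat b ^ 3) + 4 * (of_nat a ^ 3 * of_nat b ^ 1)" for a b
    unfolding g_def h_def form4_def by algebra
  have summand: "30 * ((\<Sum>a\<in>{1..<d}. g a (d - a)) - (of_nat (n div d) - 1) * h d d)
      = (let D = of_nat d in 21*D^5 + 10*D^3 - D - 30 * of_nat n*D^3)" if d: "d dvd n" "0 < n" for d
  proof -
    have "0 < d"
      using d by (rule dvd_pos_nat[rotated])
    have h: "h d d = of_nat d ^ 4"
      unfolding h_def form4_def by algebra
    have "of_nat n = (of_nat (n div d) * of_nat d :: 'a)"
      using d by (simp flip: of_nat_mult)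
    with sum_form4[OF \<open>0 < d\<close>, where 'a = 'a] show ?thesis
      unfolding right_diff_distrib g_def h Let_def by algebra
  qed
  have "(\<Sum>(a, b, x, y)\<in>quads n. g a b - h a b) = 4 * fps_nth (sigma_fps 1 * sigma_fps 3) n
      + 4 * fps_nth (sigma_fps 3 * sigma_fps 1) n"
    unfolding gh sigma_fps_mult_nth
    by (simp add: sum_distrib_left sum.distrib sum_subtractf case_prod_unfold)
  then have "fps_nth ?lhs n = 30 * (\<Sum>(a, b, x, y)\<in>quads n. g a b - h a b)"
    by (simp add: fps_numeral_mult_nth fps_mult_numeral_nth mult.commute)
  also have "\<dots> = (\<Sum>d | d dvd n. 30 * ((\<Sum>a\<in>{1..<d}. g a (d - a)) - (of_nat (n div d)
      - 1) * h d d))"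
    by (subst sum_quads_diff_divisors, (simp_all add: g_def h_def form4_def sum_distrib_left)[3]) algebra+
  also have "\<dots> = fps_nth ?rhs n"
  proof (cases "n = 0")
    case False
    then have "(\<Sum>d | d dvd n. 30 * ((\<Sum>a\<in>{1..<d}. g a (d - a)) - (of_nat (n div d) - 1) * h d d))
        = (\<Sum>d | d dvd n. let D = of_nat d in 21*D^5 + 10*D^3 - D - 30 * of_nat n*D^3)"
      by (intro sum.cong) (simp_all only: summand mem_Collect_eq not_gr_zero[symmetric] not_not)
    also have "\<dots> = fps_nth ?rhs n"
      by (simp add: Let_def fps_numeral_mult_nth fps_mult_numeral_nth sigma_fps_nth theta_nth divisor_sigma_def
          sum.distrib
          sum_subtractf sum_distrib_left algebra_simps)
    finally show ?thesis .
  qed (simp add: fps_numeral_mult_nth fps_mult_numeral_nth sigma_fps_nth theta_nth divisor_sigma_0)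
  finally show "fps_nth ?lhs n = fps_nth ?rhs n" .
qed

text \<open>The left side is, up to the factor 24, the quadratic part of
  \<open>eisenstein2 * eisenstein6 - eisenstein4\<^sup>2\<close>.\<close>

lemma sigma_1_5: "504 * (sigma_fps 1 * sigma_fps 5) - 2400 * (sigma_fps 3 * sigma_fps 3)
    = (21 * sigma_fps 5 + 20 * sigma_fps 3 + sigma_fps 1
        - 42 * theta (sigma_fps 5) :: 'a::field_char_0 fps)" (is "?lhs = ?rhs")
proof (rule fps_ext)
  fix n
  define g h where "g a b = form6 (of_nat a) (of_nat b :: 'a)"
    and "h a b = form6 (of_nat a) (- of_nat b :: 'a)" for a b
  have gh: "g a b - h a b = 252 * (of_nat a ^ 1 * of_nat b ^ 5) + 252 * (of_nat a ^ 5 * of_nat b ^ 1)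
      - 2400 * (of_nat a ^ 3 * of_nat b ^ 3)" for a b
    unfolding g_def h_def form6_def by algebra
  have summand: "(\<Sum>a\<in>{1..<d}. g a (d - a)) - (of_nat (n div d) - 1) * h d d
      = (let D = of_nat d in 21*D^5 + 20*D^3 + D - 42 * of_nat n*D^5)" if d: "d dvd n" "0 < n" for d
  proof -
    have "0 < d"
      using d by (rule dvd_pos_nat[rotated])
    have h: "h d d = 42 * of_nat d ^ 6"
      by (simp add: h_def form6_def power2_eq_square eval_nat_numeral mult_ac)
    have "of_nat n = (of_nat (n div d) * of_nat d :: 'a)"
      using d by (simp flip: of_nat_mult)
    with sum_form6[OF \<open>0 < d\<close>, where 'a = 'a] show ?thesis
      unfolding right_diff_distrib g_def h Let_def by algebra
  qed
  have "(\<Sum>(a, b, x, y)\<in>quads n. g a b - h a b) = 252 * fps_nth (sigma_fps 1 * sigma_fps 5) n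
      + 252 * fps_nth (sigma_fps 5 * sigma_fps 1) n
      - 2400 * fps_nth (sigma_fps 3 * sigma_fps 3) n"
    unfolding gh sigma_fps_mult_nth
    by (simp add: sum_distrib_left sum.distrib sum_subtractf case_prod_unfold)
  then have "fps_nth ?lhs n = (\<Sum>(a, b, x, y)\<in>quads n. g a b - h a b)"
    by (simp add: fps_numeral_mult_nth fps_mult_numeral_nth mult.commute)
  also have "\<dots> = (\<Sum>d | d dvd n. (\<Sum>a\<in>{1..<d}. g a (d - a)) - (of_nat (n div d) - 1) * h d d)"
    by (subst sum_quads_diff_divisors, (simp_all add: g_def h_def form6_def sum_distrib_left)[3]) algebra+
  also have "\<dots> = fps_nth ?rhs n"
  proof (cases "n = 0")
    case False
    then have "(\<Sum>d | d dvd n. (\<Sum>a\<in>{1..<d}. g a (d - a)) - (of_nat (n div d) - 1) * h d d)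
        = (\<Sum>d | d dvd n. let D = of_nat d in 21*D^5 + 20*D^3 + D - 42 * of_nat n*D^5)"
      by (intro sum.cong) (simp_all only: summand mem_Collect_eq not_gr_zero[symmetric] not_not)
    also have "\<dots> = fps_nth ?rhs n"
      by (simp add: Let_def fps_numeral_mult_nth fps_mult_numeral_nth sigma_fps_nth theta_nth divisor_sigma_def
          sum.distrib
          sum_subtractf sum_distrib_left algebra_simps)
    finally show ?thesis .
  qed (simp add: fps_numeral_mult_nth fps_mult_numeral_nth sigma_fps_nth theta_nth divisor_sigma_0)
  finally show "fps_nth ?lhs n = fps_nth ?rhs n" .
qed

section \<open>The Euler product\<close>

definition euler_fun :: "complex \<Rightarrow> complex" where
  "euler_fun q = (\<Prod>n. 1 - q ^ Suc n)"

lemma one_minus_power_nonzero: "norm q < 1 \<Longrightarrow> 1 - q ^ Suc n \<noteq> (0::complex)"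
  by (metis eq_iff_diff_eq_0 norm_one norm_power power_less_one_iff less_irrefl norm_ge_zero zero_less_Suc)

lemma convergent_prod_euler:
  assumes "norm q < 1"
  shows "convergent_prod (\<lambda>n. 1 - q ^ Suc n :: complex)"
proof -
  have "summable (\<lambda>n. norm (1 - q ^ Suc n - 1))"
    using assms by (simp add: norm_power norm_mult summable_mult summable_geometric)
  then show ?thesis
    by (simp add: abs_convergent_prod_conv_summable abs_convergent_prod_imp_convergent_prod)
qed

lemma euler_fun_nonzero: "norm q < 1 \<Longrightarrow> euler_fun q \<noteq> 0"
  unfolding euler_fun_def by (intro prodinf_nonzero convergent_prod_euler one_minus_power_nonzero)

lemma euler_fun_uniform_limit:
  assumes "r < 1"
  shows "uniform_limit (cball 0 r) (\<lambda>N q. \<Prod>n<N. 1 - q ^ Suc n) euler_fun sequentially"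
proof (cases "r < 0")
  case False
  have "uniformly_convergent_on (cball 0 r) (\<lambda>N q. \<Prod>n<N. 1 - q ^ Suc n :: complex)"
  proof (rule uniformly_convergent_on_prod')
    show "uniformly_convergent_on (cball 0 r) (\<lambda>N q::complex. \<Sum>n<N. norm (1 - q ^ Suc n - 1))"
    proof (rule Weierstrass_m_test')
      show "norm (norm (1 - q ^ Suc n - 1)) \<le> r ^ Suc n" if "q \<in> cball 0 r" for n and q :: complex
        using that by (simp add: norm_power power_mono del: power_Suc)
      show "summable (\<lambda>n. r ^ Suc n)"
        using assms False by (simp add: summable_mult summable_geometric)
    qed
  qed (auto intro!: continuous_intros)
  then obtain g where g: "uniform_limit (cball 0 r) (\<lambda>N q. \<Prod>n<N. 1
      - q ^ Suc n :: complex) g sequentially"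
    unfolding uniformly_convergent_on_def ..
  have "g q = euler_fun q" if "q \<in> cball 0 r" for q
  proof -
    have "norm q < 1"
      using that assms by simp
    then have "(\<lambda>N. \<Prod>n<N. 1 - q ^ Suc n) \<longlonglongrightarrow> euler_fun q"
      unfolding euler_fun_def by (intro has_prod_imp_tendsto' convergent_prod_has_prod convergent_prod_euler)
    with tendsto_uniform_limitI[OF g that] show ?thesis
      by (rule LIMSEQ_unique)
  qed
  then have "uniform_limit (cball 0 r) (\<lambda>N q. \<Prod>n<N. 1 - q ^ Suc n) g sequentially
      = uniform_limit (cball 0 r) (\<lambda>N q. \<Prod>n<N. 1 - q ^ Suc n) euler_fun sequentially"
    by (intro uniform_limit_cong') auto
  with g show ?thesis
    by simp
qed simp

lemma holomorphic_euler_fun: "euler_fun holomorphic_on ball 0 1"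
proof (rule holomorphic_uniform_sequence[where f = "\<lambda>N q. \<Prod>n<N. 1 - q ^ Suc n"])
  fix q :: complex assume q: "q \<in> ball 0 1"
  define d where "d = (1 - norm q) / 2"
  have "cball q d \<subseteq> cball 0 (norm q + d)"
    by (metis add.commute cball_subset_cball_iff cball_subset_ball_iff dist_0_norm dist_commute order_refl)
  moreover have "0 < d" "norm q + d < 1"
    using q by (auto simp: d_def field_simps)
  ultimately show "\<exists>d>0. cball q d \<subseteq> ball 0 1 \<and>
      uniform_limit (cball q d) (\<lambda>N q. \<Prod>n<N. 1 - q ^ Suc n) euler_fun sequentially"
    by (intro exI[of _ d] conjI uniform_limit_on_subset[OF euler_fun_uniform_limit]) auto
qed (auto intro!: holomorphic_intros)

lemma euler_fun_0: "euler_fun 0 = 1"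
  by (simp add: euler_fun_def)

definition euler_fps :: "complex fps" where
  "euler_fps = fps_expansion euler_fun 0"

lemma has_fps_expansion_euler: "euler_fun has_fps_expansion euler_fps"
  unfolding euler_fps_def
  by (rule has_fps_expansion_fps_expansion[OF _ _ holomorphic_euler_fun]) auto

lemma euler_fps_0: "fps_nth euler_fps 0 = 1"
  using has_fps_expansion_imp_0_eq_fps_nth_0[OF has_fps_expansion_euler] by (simp add: euler_fun_0)

section \<open>Logarithmic derivative of the Euler product, through the Lambert terms k X^k / (1 -
  X^k)\<close>

definition lambert :: "nat \<Rightarrow> 'a::comm_ring_1 fps" where
  "lambert k = Abs_fps (\<lambda>n. if 0 < n \<and> k dvd n then of_nat k else 0)"

lemma lambert_mult: "0 < k \<Longrightarrow> (1 - fps_X ^ k) * lambert k = of_nat k * fps_X ^ k"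
  by (rule fps_ext) (auto simp: left_diff_distrib fps_X_power_mult_nth fps_X_power_nth lambert_def
      fps_of_nat[symmetric] dvd_minus_self)

definition euler_partial :: "nat \<Rightarrow> 'a::comm_ring_1 fps" where
  "euler_partial N = (\<Prod>n<N. 1 - fps_X ^ Suc n)"

lemma theta_fps_X_power: "theta (fps_X ^ k) = of_nat k * fps_X ^ k"
  by (rule fps_ext) (simp add: theta_nth fps_X_power_nth fps_of_nat[symmetric])

lemma theta_euler_partial:
  "theta (euler_partial N) = - euler_partial N * (\<Sum>k<N. lambert (Suc k))"
proof (induction N)
  case (Suc N)
  have "theta (euler_partial (Suc N)) = - (euler_partial N * (\<Sum>k<N. lambert (Suc k))) * (1 - fps_X ^ Suc N)
      - euler_partial N * (of_nat (Suc N) * fps_X ^ Suc N :: 'a fps)"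
    using Suc.IH by (simp add: euler_partial_def theta_mult theta_diff theta_1 theta_fps_X_power del:
        of_nat_Suc power_Suc)
  also have "of_nat (Suc N) * fps_X ^ Suc N = (1 - fps_X ^ Suc N) * lambert (Suc N)"
    by (simp add: lambert_mult del: of_nat_Suc power_Suc)
  finally show ?case
    by (simp add: euler_partial_def algebra_simps del: of_nat_Suc power_Suc)
qed (simp add: euler_partial_def theta_1)

lemma sum_lambert_nth:
  assumes "n \<le> N"
  shows "fps_nth (\<Sum>k<N. lambert (Suc k)) n = fps_nth (sigma_fps 1) n"
proof (cases "n = 0")
  case False
  have "fps_nth (\<Sum>k<N. lambert (Suc k)) n = (\<Sum>k | k < N \<and> Suc k dvd n. of_nat (Suc k))"
    using False by (simp add: fps_sum_nth lambert_def sum.If_cases Int_def del: of_nat_Suc)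
  also have "\<dots> = (\<Sum>d | d dvd n. of_nat d)"
    using False assms
    by (intro sum.reindex_bij_witness[where i = "\<lambda>d. d - 1" and j = Suc])
      (auto dest: dvd_imp_le dvd_pos_nat)
  finally show ?thesis
    by (simp add: sigma_fps_nth divisor_sigma_def)
qed (simp add: fps_sum_nth lambert_def sigma_fps_nth divisor_sigma_0)

text \<open>Uniform convergence of holomorphic functions near 0 carries over to all derivatives at
  0, hence to Taylor coefficients. This links the formal partial products to the analytic infinite
  product.\<close>

lemma euler_partial_nth_tendsto: "(\<lambda>N. fps_nth (euler_partial N) n) \<longlonglongrightarrow> fps_nth
    euler_fps n"
proof -
  have "(\<lambda>N. (deriv ^^ n) (\<lambda>q. \<Prod>n<N. 1
      - q ^ Suc n) 0) \<longlonglongrightarrow> (deriv ^^ n) euler_fun (0::complex)"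
  proof (rule higher_deriv_complex_uniform_limit[where A = "ball 0 (1/2)"])
    show "uniform_limit (ball 0 (1/2)) (\<lambda>N q. \<Prod>n<N. 1 - q ^ Suc n) euler_fun sequentially"
      by (rule uniform_limit_on_subset[OF euler_fun_uniform_limit[of "1/2"]]) auto
  qed (auto intro!: always_eventually holomorphic_intros)
  then have "(\<lambda>N. (deriv ^^ n) (\<lambda>q. \<Prod>n<N. 1
      - q ^ Suc n) 0 / fact n) \<longlonglongrightarrow> (deriv ^^ n) euler_fun (0::complex) / fact n"
    by (intro tendsto_intros) auto
  moreover have "fps_nth (euler_partial N) n = (deriv ^^ n) (\<lambda>q. \<Prod>n<N. 1
      - q ^ Suc n) (0::complex) / fact n" for N
    unfolding euler_partial_def by (intro fps_nth_fps_expansion fps_expansion_intros)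
  ultimately show ?thesis
    by (simp only: fps_nth_fps_expansion[OF has_fps_expansion_euler])
qed

text \<open>The limit of \<open>theta_euler_partial\<close> in a fixed coefficient \<open>n\<close>:
  the Lambert sum already has its final coefficients up to \<open>n\<close> as soon as
  \<open>n \<le> N\<close>.\<close>

lemma theta_euler_fps: "theta euler_fps = - sigma_fps 1 * euler_fps"
proof (rule fps_ext)
  fix n
  have "(\<lambda>N. of_nat n * fps_nth (euler_partial N) n) \<longlonglongrightarrow> of_nat n * fps_nth euler_fps n"
    by (intro tendsto_intros euler_partial_nth_tendsto)
  moreover have "(\<lambda>N. of_nat n * fps_nth (euler_partial N) n) \<longlonglongrightarrow>
      - (\<Sum>i=0..n. fps_nth euler_fps i * fps_nth (sigma_fps 1) (n - i))"
  proof (rule Lim_transform_eventually)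
    show "(\<lambda>N. - (\<Sum>i=0..n. fps_nth (euler_partial N) i * fps_nth (sigma_fps 1) (n - i)))
        \<longlonglongrightarrow> - (\<Sum>i=0..n. fps_nth euler_fps i * fps_nth (sigma_fps 1) (n - i))"
      by (intro tendsto_intros euler_partial_nth_tendsto)
    show "\<forall>\<^sub>F N in sequentially.
        - (\<Sum>i=0..n. fps_nth (euler_partial N) i * fps_nth (sigma_fps 1) (n - i))
        = of_nat n * fps_nth (euler_partial N :: complex fps) n"
      using eventually_ge_at_top[of n]
    proof eventually_elim
      case (elim N)
      have "of_nat n * fps_nth (euler_partial N :: complex fps) n = fps_nth (theta (euler_partial N)) n"
        by (simp add: theta_nth)
      also have "\<dots> =
          - (\<Sum>i=0..n. fps_nth (euler_partial N) i * fps_nth (\<Sum>k<N. lambert (Suc k)) (n - i))"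
        by (simp add: theta_euler_partial fps_mult_nth)
      also have "\<dots> = - (\<Sum>i=0..n. fps_nth (euler_partial N) i * fps_nth (sigma_fps 1) (n - i))"
        using elim by (intro arg_cong[of _ _ uminus] sum.cong refl arg_cong2[of _ _ _ _ "(*)"] sum_lambert_nth) auto
      finally show ?case ..
    qed
  qed
  ultimately have "of_nat n * fps_nth euler_fps n = - fps_nth (euler_fps * sigma_fps 1) n"
    unfolding fps_mult_nth by (rule LIMSEQ_unique)
  then show "fps_nth (theta euler_fps) n = fps_nth (- sigma_fps 1 * euler_fps) n"
    by (simp add: theta_nth mult.commute)
qed

section \<open>Eisenstein series and eta quotients of level 15\<close>

lemma fps_compose_X_power_nth:
  fixes f :: "'a::comm_ring_1 fps"
  assumes "0 < d"
  shows "fps_nth (f oo fps_X ^ d) n = (if d dvd n then fps_nth f (n div d) else 0)"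
proof -
  have "fps_nth (f oo fps_X ^ d) n = (\<Sum>i=0..n. if n = d * i then fps_nth f i else 0)"
    unfolding fps_compose_nth by (intro sum.cong refl) (simp add: fps_X_power_nth flip: power_mult)
  also have "\<dots> = (\<Sum>i=0..n. if d dvd n \<and> i = n div d then fps_nth f i else 0)"
    using assms by (intro sum.cong refl) auto
  also have "\<dots> = (if d dvd n then fps_nth f (n div d) else 0)"
    by (simp add: sum.delta')
  finally show ?thesis .
qed

lemma theta_compose_X_power:
  fixes f :: "'a::comm_ring_1 fps"
  assumes "0 < d"
  shows "theta (f oo fps_X ^ d) = of_nat d * (theta f oo fps_X ^ d)"
  using assms
  by (intro fps_ext) (auto simp: theta_nth fps_compose_X_power_nth fps_of_nat[symmetric] simp flip: mult.assoc
      of_nat_mult)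

lemma fps_compose_numeral: "numeral k oo (g :: 'a::idom fps) = numeral k"
  by (simp add: numeral_fps_const)

definition eisenstein2 :: "'a::comm_ring_1 fps" where "eisenstein2 = 1 - 24 * sigma_fps 1"
definition eisenstein4 :: "'a::comm_ring_1 fps" where "eisenstein4 = 1 + 240 * sigma_fps 3"
definition eisenstein6 :: "'a::comm_ring_1 fps" where "eisenstein6 = 1 - 504 * sigma_fps 5"

lemma theta_eisenstein2: "12 * theta eisenstein2 = eisenstein2\<^sup>2 - (eisenstein4 :: 'a::field_char_0 fps)"
  using sigma_1_1[where 'a = 'a]
  unfolding eisenstein2_def eisenstein4_def theta_simps by algebra

lemma theta_eisenstein4: "3 * theta eisenstein4 = eisenstein2 * eisenstein4 - (eisenstein6 :: 'a::field_char_0 fps)"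
  using sigma_1_3[where 'a = 'a]
  unfolding eisenstein2_def eisenstein4_def eisenstein6_def theta_simps by algebra

lemma theta_eisenstein6: "2 * theta eisenstein6 = eisenstein2 * eisenstein6
    - (eisenstein4 :: 'a::field_char_0 fps)\<^sup>2"
  using sigma_1_5[where 'a = 'a]
  unfolding eisenstein2_def eisenstein4_def eisenstein6_def theta_simps by algebra

text \<open>The weights \<open>d\<close>, \<open>d\<^sup>2\<close>, \<open>d\<^sup>3\<close> make Ramanujan's
    differential equations independent of the level \<open>d\<close>.\<close>

definition P_lvl :: "nat \<Rightarrow> 'a::comm_ring_1 fps" where
  "P_lvl d = of_nat d * (eisenstein2 oo fps_X ^ d)"
definition S_lvl :: "nat \<Rightarrow> 'a::comm_ring_1 fps" where
  "S_lvl d = of_nat d ^ 2 * (eisenstein4 oo fps_X ^ d)"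
definition R_lvl :: "nat \<Rightarrow> 'a::comm_ring_1 fps" where
  "R_lvl d = of_nat d ^ 3 * (eisenstein6 oo fps_X ^ d)"

lemma
  assumes "0 < d"
  shows theta_P_lvl: "12 * theta (P_lvl d) = P_lvl d ^ 2 - (S_lvl d :: 'a::field_char_0 fps)"
    and theta_S_lvl: "3 * theta (S_lvl d) = P_lvl d * S_lvl d - (R_lvl d :: 'a fps)"
    and theta_R_lvl: "2 * theta (R_lvl d) = P_lvl d * R_lvl d - (S_lvl d :: 'a fps) ^ 2"
proof -
  have X: "fps_nth (fps_X ^ d :: 'a fps) 0 = 0"
    using assms by simp
  note distrib = fps_compose_mult_distrib[OF X] fps_compose_sub_distrib fps_compose_numeral
      fps_compose_power[OF X, symmetric]
  note th = theta_simps theta_compose_X_power[OF assms]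
  show "12 * theta (P_lvl d) = P_lvl d ^ 2 - (S_lvl d :: 'a fps)"
    using arg_cong[OF theta_eisenstein2, of "\<lambda>f :: 'a fps. f oo fps_X ^ d"]
    by (simp add: P_lvl_def S_lvl_def distrib th) algebra
  show "3 * theta (S_lvl d) = P_lvl d * S_lvl d - (R_lvl d :: 'a fps)"
    using arg_cong[OF theta_eisenstein4, of "\<lambda>f :: 'a fps. f oo fps_X ^ d"]
    by (simp add: P_lvl_def S_lvl_def R_lvl_def distrib th) algebra
  show "2 * theta (R_lvl d) = P_lvl d * R_lvl d - (S_lvl d :: 'a fps) ^ 2"
    using arg_cong[OF theta_eisenstein6, of "\<lambda>f :: 'a fps. f oo fps_X ^ d"]
    by (simp add: P_lvl_def S_lvl_def R_lvl_def distrib th) algebra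
qed

section \<open>Eta quotients and their logarithmic derivatives\<close>

definition eta_lvl :: "nat \<Rightarrow> complex fps" where
  "eta_lvl d = euler_fps oo fps_X ^ d"

lemma eta_lvl_0: "0 < d \<Longrightarrow> fps_nth (eta_lvl d) 0 = 1"
  by (simp add: eta_lvl_def euler_fps_0)

lemma theta_inverse:
  fixes f :: "'a::field fps"
  assumes "fps_nth f 0 \<noteq> 0" "theta f = l * f"
  shows "theta (inverse f) = - l * inverse f"
proof -
  have 1: "inverse f * f = 1"
    using assms(1) by (rule inverse_mult_eq_1)
  then have "theta (inverse f * f) = 0"
    by (simp add: theta_1)
  with 1 show ?thesis
    unfolding theta_mult assms(2) by algebra
qed

definition sigma_lvl :: "nat \<Rightarrow> 'a::comm_ring_1 fps" where
  "sigma_lvl d = of_nat d * (sigma_fps 1 oo fps_X ^ d)"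

lemma P_lvl_eq: "0 < d \<Longrightarrow> P_lvl d = of_nat d - 24 * (sigma_lvl d :: 'a::idom fps)"
  by (simp add: P_lvl_def eisenstein2_def sigma_lvl_def fps_compose_sub_distrib algebra_simps
      fps_compose_mult_distrib fps_compose_numeral)

lemma theta_eta_lvl: "0 < d \<Longrightarrow> theta (eta_lvl d) = - sigma_lvl d * eta_lvl d"
  by (simp add: eta_lvl_def theta_compose_X_power theta_euler_fps fps_compose_mult_distrib sigma_lvl_def
      fps_compose_uminus)

lemma theta_mult_log: "theta f = l * f \<Longrightarrow> theta g = m * g \<Longrightarrow> theta (f * g) = (l
    + m) * (f * g)"
  by (simp add: theta_mult algebra_simps)

lemma theta_power_log: "theta f = l * f \<Longrightarrow> theta (f ^ k) = of_nat k * l * f ^ k"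
  unfolding theta_power by (cases k) (simp_all add: mult_ac)

lemmas theta_log = theta_mult_log theta_power_log theta_eta_lvl theta_fps_X_power theta_inverse

text \<open>The powers of \<open>fps_X\<close> in this and the next two definitions collect the
  factors q^(d/24): the exponents add up to 1, 2 and 0. Writing \<open>fps_X ^ 1\<close> lets
  \<open>theta_log\<close> apply as it stands.\<close>

definition eta_T :: "complex fps" where
  "eta_T = fps_X ^ 1 * (eta_lvl 1 * eta_lvl 3 * eta_lvl 5 * eta_lvl 15)"
definition eta_x :: "complex fps" where
  "eta_x = fps_X ^ 2 * (eta_lvl 1 ^ 4 * eta_lvl 15 ^ 4 * inverse (eta_lvl 3 ^ 2 * eta_lvl 5 ^ 2))"
definition eta_y :: "complex fps" where
  "eta_y = eta_lvl 3 ^ 4 * eta_lvl 5 ^ 4 * inverse (eta_lvl 1 ^ 2 * eta_lvl 15 ^ 2)"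

lemma inverse_eta_lvl:
  "inverse (eta_lvl 3 ^ 2 * eta_lvl 5 ^ 2) * (eta_lvl 3 ^ 2 * eta_lvl 5 ^ 2) = 1"
  "inverse (eta_lvl 1 ^ 2 * eta_lvl 15 ^ 2) * (eta_lvl 1 ^ 2 * eta_lvl 15 ^ 2) = 1"
  by (rule inverse_mult_eq_1, simp add: eta_lvl_0 fps_power_zeroth)+

lemma eta_xy: "eta_x * eta_y = eta_T ^ 2"
proof -
  have "eta_x * eta_y = eta_T ^ 2 * (inverse (eta_lvl 3 ^ 2 * eta_lvl 5 ^ 2) * (eta_lvl 3 ^ 2 * eta_lvl 5 ^ 2))
      * (inverse (eta_lvl 1 ^ 2 * eta_lvl 15 ^ 2) * (eta_lvl 1 ^ 2 * eta_lvl 15 ^ 2))"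
    by (simp add: eta_x_def eta_y_def eta_T_def power_mult_distrib eval_nat_numeral mult_ac)
  then show ?thesis
    by (simp only: inverse_eta_lvl mult_1_right)
qed

text \<open>\<open>L_fps\<close> and \<open>w_fps\<close> are the logarithmic derivatives of \<open>T\<close>
    and of \<open>x / T\<close>.\<close>

definition L_fps :: "complex fps" where
  "L_fps = 1 - (sigma_lvl 1 + sigma_lvl 3 + sigma_lvl 5 + sigma_lvl 15)"
definition w_fps :: "complex fps" where
  "w_fps = 1 - 3 * (sigma_lvl 1 - sigma_lvl 3 - sigma_lvl 5 + sigma_lvl 15)"

lemma theta_eta_T: "theta eta_T = L_fps * eta_T"
proof -
  have "theta eta_T = (of_nat 1 + (- sigma_lvl 1 + - sigma_lvl 3 + - sigma_lvl 5 + - sigma_lvl 15)) * eta_T"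
    unfolding eta_T_def by (intro theta_log) simp_all
  then show ?thesis
    by (simp add: L_fps_def algebra_simps)
qed

lemma theta_eta_x: "theta eta_x = (L_fps + w_fps) * eta_x"
proof -
  have "theta eta_x = (of_nat 2 + (of_nat 4 * (- sigma_lvl 1) + of_nat 4 * (- sigma_lvl 15)
      + - (of_nat 2 * (- sigma_lvl 3) + of_nat 2 * (- sigma_lvl 5)))) * eta_x"
    unfolding eta_x_def by (intro theta_log) (simp_all add: eta_lvl_0 fps_power_zeroth)
  then show ?thesis
    by (simp add: L_fps_def w_fps_def algebra_simps)
qed

lemma theta_eta_y: "theta eta_y = (L_fps - w_fps) * eta_y"
proof -
  have "theta eta_y = (of_nat 4 * (- sigma_lvl 3) + of_nat 4 * (- sigma_lvl 5)
      + - (of_nat 2 * (- sigma_lvl 1) + of_nat 2 * (- sigma_lvl 15))) * eta_y"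
    unfolding eta_y_def by (intro theta_log) (simp_all add: eta_lvl_0 fps_power_zeroth)
  then show ?thesis
    by (simp add: L_fps_def w_fps_def algebra_simps)
qed

section \<open>Initial coefficients by computation\<close>

definition sigma_list :: "nat \<Rightarrow> int" where
  "sigma_list n = (\<Sum>d\<leftarrow>filter (\<lambda>d. d dvd n) [1..<Suc n]. int d)"

lemma divisor_sigma_1_eq: "0 < n \<Longrightarrow> int (divisor_sigma 1 n) = sigma_list n"
proof -
  assume "0 < n"
  then have "{d. d dvd n} = set (filter (\<lambda>d. d dvd n) [1..<Suc n])"
    by (auto dest: dvd_imp_le simp: Suc_le_eq dvd_pos_nat)
  then show ?thesis
    unfolding sigma_list_def divisor_sigma_def by (simp add: sum_list_distinct_conv_sum_set flip: of_nat_sum)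
qed

definition sigma_lvl_list :: "nat \<Rightarrow> nat \<Rightarrow> int" where
  "sigma_lvl_list d n = (if 0 < n \<and> d dvd n then int d * sigma_list (n div d) else 0)"

lemma sigma_lvl_list_0: "sigma_lvl_list d 0 = 0"
  by (simp add: sigma_lvl_list_def)

lemma sigma_lvl_nth:
  assumes "0 < d"
  shows "fps_nth (sigma_lvl d) n = (of_int (sigma_lvl_list d n) :: 'a::comm_ring_1)"
proof (cases "0 < n \<and> d dvd n")
  case True
  with assms have "0 < n div d"
    by (simp add: dvd_div_pos)
  with True show ?thesis
    using assms divisor_sigma_1_eq[of "n div d", symmetric]
    by (simp add: sigma_lvl_def sigma_lvl_list_def fps_of_nat[symmetric] fps_compose_X_power_nth sigma_fps_nth)
next
  case False
  then show ?thesis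
    using assms
    by (auto simp: sigma_lvl_def sigma_lvl_list_def fps_of_nat[symmetric] fps_compose_X_power_nth sigma_fps_nth
        divisor_sigma_0)
qed

text \<open>\<open>theta f = l * f\<close> is a recursion for the coefficients of \<open>f\<close>;
  since \<open>g 0 = 0\<close>, it involves only earlier ones. So a candidate list is correct once
  it has the right start and passes the finite check \<open>step\<close>.\<close>

lemma fps_nth_by_log_deriv:
  fixes f :: "'a::field_char_0 fps" and cs :: "int list"
  assumes "theta f = l * f" and "fps_nth f 0 = of_int (cs ! 0)"
    and "\<And>i. fps_nth l i = of_int (g i)" "g 0 = 0"
    and step: "\<forall>n\<in>set [1..<N]. int n * cs ! n = (\<Sum>i\<leftarrow>[1..<Suc n]. g i * cs ! (n - i))"
    and "n < N"
  shows "fps_nth f n = of_int (cs ! n)"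
  using \<open>n < N\<close>
proof (induction n rule: less_induct)
  case (less n)
  show ?case
  proof (cases "n = 0")
    case False
    have "of_nat n * fps_nth f n = fps_nth (l * f) n"
      using assms(1) by (metis theta_nth)
    also have "\<dots> = (\<Sum>i\<in>{1..n}. fps_nth l i * fps_nth f (n - i))"
      unfolding fps_mult_nth by (rule sum.mono_neutral_right) (auto simp: assms(3,4) Suc_le_eq)
    also have "\<dots> = (\<Sum>i\<in>{1..n}. of_int (g i * cs ! (n - i)))"
      using less by (intro sum.cong) (auto simp: assms(3))
    also have "\<dots> = of_int (\<Sum>i\<leftarrow>[1..<Suc n]. g i * cs ! (n - i))"
      by (simp add: sum_list_distinct_conv_sum_set atLeastLessThanSuc_atLeastAtMost del: upt_Suc)
    also have "\<dots> = of_int (int n * cs ! n)"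
      using step less.prems False by (subst bspec[OF step, symmetric]) auto
    finally show ?thesis
      using False by simp
  qed (simp add: assms(2))
qed

lemma eta_lvl_mult_0: "0 < d \<Longrightarrow> fps_nth (eta_lvl d ^ k) 0 = 1"
  by (simp add: eta_lvl_0 fps_power_zeroth)

text \<open>The list belongs to the quotient of \<open>eta_T\<close> by \<open>fps_X\<close>, hence
  the shift. The range reaches the last resonance, 15.\<close>

lemma eta_T_nth:
  assumes "n < 15"
  shows "fps_nth eta_T (Suc n) = of_int ([1, -1, -1, -1, 1, 1, 0, 3, 1, -1, -4, 1, -2, 0, -1] ! n)"
proof -
  let ?f = "eta_lvl 1 * eta_lvl 3 * eta_lvl 5 * eta_lvl 15"
  have "theta ?f = (- sigma_lvl 1 + - sigma_lvl 3 + - sigma_lvl 5 + - sigma_lvl 15) * ?f"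
    by (intro theta_log) simp_all
  then have "fps_nth ?f n = of_int ([1, -1, -1, -1, 1, 1, 0, 3, 1, -1, -4, 1, -2, 0, -1] ! n)"
  proof (rule fps_nth_by_log_deriv[OF _ _ _ _ _ assms])
    let ?g = "\<lambda>i. - sigma_lvl_list 1 i + - sigma_lvl_list 3 i + - sigma_lvl_list 5 i + - sigma_lvl_list 15 i"
    show "fps_nth (- sigma_lvl 1 + - sigma_lvl 3 + - sigma_lvl 5 + - sigma_lvl 15) i = of_int (?g i)" for i
      by (simp add: sigma_lvl_nth)
    show "\<forall>n\<in>set [1..<15]. int n * [1, -1, -1, -1, 1, 1, 0, 3, 1, -1, -4, 1, -2, 0, -1] ! n =
        (\<Sum>i\<leftarrow>[1..<Suc n]. ?g i * [1, -1, -1, -1, 1, 1, 0, 3, 1, -1, -4, 1, -2, 0, -1] ! (n - i))"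
      by code_simp
  qed (simp_all add: eta_lvl_0 sigma_lvl_list_def)
  then show ?thesis
    by (simp add: eta_T_def fps_X_power_mult_nth)
qed

lemma eta_x_nth:
  assumes "2 \<le> n" "n < 16"
  shows "fps_nth eta_x n = of_int ([1, -4, 2, 10, -13, 2, 3, -18, 31, 4, -30, 4, 6, 6] ! (n - 2))"
proof -
  let ?f = "eta_lvl 1 ^ 4 * eta_lvl 15 ^ 4 * inverse (eta_lvl 3 ^ 2 * eta_lvl 5 ^ 2)"
  let ?l = "of_nat 4 * (- sigma_lvl 1) + of_nat 4 * (- sigma_lvl 15)
      + - (of_nat 2 * (- sigma_lvl 3) + of_nat 2 * (- sigma_lvl 5)) :: complex fps"
  have "theta ?f = ?l * ?f"
    by (intro theta_log) (simp_all add: eta_lvl_mult_0)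
  then have "fps_nth ?f n = of_int ([1, -4, 2, 10, -13, 2, 3, -18, 31, 4, -30, 4, 6, 6] ! n)" if "n < 14" for n
  proof (rule fps_nth_by_log_deriv[OF _ _ _ _ _ that])
    let ?g = "\<lambda>i. - 4 * sigma_lvl_list 1 i - 4 * sigma_lvl_list 15 i + 2 * sigma_lvl_list 3 i
        + 2 * sigma_lvl_list 5 i"
    show "fps_nth ?l i = of_int (?g i)" for i
      by (simp add: sigma_lvl_nth fps_numeral_mult_nth)
    show "\<forall>n\<in>set [1..<14]. int n * [1, -4, 2, 10, -13, 2, 3, -18, 31, 4, -30, 4, 6, 6] ! n =
        (\<Sum>i\<leftarrow>[1..<Suc n]. ?g i * [1, -4, 2, 10, -13, 2, 3, -18, 31, 4, -30, 4, 6, 6] ! (n - i))"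
      by code_simp
  qed (simp_all add: eta_lvl_mult_0 sigma_lvl_list_def)
  from this[of "n - 2"] show ?thesis
    using assms by (simp add: eta_x_def fps_X_power_mult_nth)
qed

lemma eta_y_nth:
  assumes "n < 16"
  shows "fps_nth eta_y n = of_int ([1, 2, 5, 6, 12, 12, 19, 14, 27, 20, 35, 20, 44, 24, 42, 16] ! n)"
proof -
  let ?l = "of_nat 4 * (- sigma_lvl 3) + of_nat 4 * (- sigma_lvl 5)
      + - (of_nat 2 * (- sigma_lvl 1) + of_nat 2 * (- sigma_lvl 15)) :: complex fps"
  have "theta eta_y = ?l * eta_y"
    unfolding eta_y_def by (intro theta_log) (simp_all add: eta_lvl_mult_0)
  then show ?thesis
  proof (rule fps_nth_by_log_deriv[OF _ _ _ _ _ assms])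
    let ?g = "\<lambda>i. - 4 * sigma_lvl_list 3 i - 4 * sigma_lvl_list 5 i + 2 * sigma_lvl_list 1 i
        + 2 * sigma_lvl_list 15 i"
    show "fps_nth ?l i = of_int (?g i)" for i
      by (simp add: sigma_lvl_nth fps_numeral_mult_nth)
    show "\<forall>n\<in>set [1..<16]. int n * [1, 2, 5, 6, 12, 12, 19, 14, 27, 20, 35, 20, 44, 24, 42, 16] ! n =
        (\<Sum>i\<leftarrow>[1..<Suc n]. ?g i * [1, 2, 5, 6, 12, 12, 19, 14, 27, 20, 35, 20, 44, 24, 42, 16] !
            (n - i))"
      by code_simp
  qed (simp_all add: eta_y_def eta_lvl_mult_0 sigma_lvl_list_def)
qed

lemma eta_0: "fps_nth eta_T 0 = 0" "fps_nth eta_x 0 = 0" "fps_nth eta_x 1 = 0" "fps_nth eta_y 0 = 1"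
  by (simp_all add: eta_T_def eta_x_def eta_y_def eta_lvl_mult_0 fps_X_power_mult_nth)

lemma sigma_lvl_0: "0 < d \<Longrightarrow> fps_nth (sigma_lvl d) 0 = (0 :: 'a::comm_ring_1)"
  by (simp add: sigma_lvl_nth sigma_lvl_list_def)

text \<open>The errors of the claimed relations form an instance of \<open>level15\<close>. Beyond
  constant terms, \<open>errors_eq_0\<close> asks for the coefficients 1 and 15 of \<open>a\<close>
  and 3 and 5 of \<open>b\<close>.\<close>

theorem weight_relations:
  shows P_eta: "P_lvl 1 = 6*L_fps + 2*w_fps + 2*eta_T + eta_x - 7*eta_y"
      "P_lvl 3 = 6*L_fps - 2*w_fps + 2*eta_T + 7*eta_x - eta_y"
      "P_lvl 5 = 6*L_fps - 2*w_fps - 2*eta_T - 7*eta_x + eta_y"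
      "P_lvl 15 = 6*L_fps + 2*w_fps - 2*eta_T - eta_x + 7*eta_y"
    and w2_eta: "w_fps^2 = - 13*eta_T^2 + 10*eta_T*eta_x - 10*eta_T*eta_y + eta_x^2 + eta_y^2"
    and S_eta: "S_lvl 1 = 8*w_fps*eta_T - 8*w_fps*eta_x - 112*w_fps*eta_y - 170*eta_T^2 + 68*eta_T*eta_x
        - 332*eta_T*eta_y + 17*eta_x^2 + 113*eta_y^2"
      "S_lvl 3 = - 8*w_fps*eta_T - 112*w_fps*eta_x - 8*w_fps*eta_y - 170*eta_T^2 + 332*eta_T*eta_x
          - 68*eta_T*eta_y + 113*eta_x^2 + 17*eta_y^2"
      "S_lvl 5 = 8*w_fps*eta_T + 112*w_fps*eta_x + 8*w_fps*eta_y - 170*eta_T^2 + 332*eta_T*eta_x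
          - 68*eta_T*eta_y + 113*eta_x^2 + 17*eta_y^2"
      "S_lvl 15 = - 8*w_fps*eta_T + 8*w_fps*eta_x + 112*w_fps*eta_y - 170*eta_T^2 + 68*eta_T*eta_x
          - 332*eta_T*eta_y + 17*eta_x^2 + 113*eta_y^2"
    and theta_w_eta: "theta w_fps = L_fps*w_fps + eta_x^2 + 5*eta_T*eta_x + 5*eta_T*eta_y - eta_y^2"
proof -
  define a where "a = P_lvl 1 - (6*L_fps + 2*w_fps + 2*eta_T + eta_x - 7*eta_y)"
  define b where "b = P_lvl 3 - (6*L_fps - 2*w_fps + 2*eta_T + 7*eta_x - eta_y)"
  define K where "K = w_fps^2 - (- 13*eta_T^2 + 10*eta_T*eta_x - 10*eta_T*eta_y + eta_x^2 + eta_y^2)"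
  define e1 where "e1 = S_lvl 1 - (8*w_fps*eta_T - 8*w_fps*eta_x - 112*w_fps*eta_y - 170*eta_T^2
      + 68*eta_T*eta_x - 332*eta_T*eta_y + 17*eta_x^2 + 113*eta_y^2)"
  define e3 where "e3 = S_lvl 3 - (- 8*w_fps*eta_T - 112*w_fps*eta_x - 8*w_fps*eta_y - 170*eta_T^2
      + 332*eta_T*eta_x - 68*eta_T*eta_y + 113*eta_x^2 + 17*eta_y^2)"
  define e5 where "e5 = S_lvl 5 - (8*w_fps*eta_T + 112*w_fps*eta_x + 8*w_fps*eta_y - 170*eta_T^2
      + 332*eta_T*eta_x - 68*eta_T*eta_y + 113*eta_x^2 + 17*eta_y^2)"
  define e15 where "e15 = S_lvl 15 - (- 8*w_fps*eta_T + 8*w_fps*eta_x + 112*w_fps*eta_y - 170*eta_T^2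
      + 68*eta_T*eta_x - 332*eta_T*eta_y + 17*eta_x^2 + 113*eta_y^2)"
  define r1 where "r1 = R_lvl 1 - (- 380*w_fps*eta_T^2 - 76*w_fps*eta_T*eta_x - 1940*w_fps*eta_T*eta_y
      - 76*w_fps*eta_x^2 + 1688*w_fps*eta_y^2 - 5236*eta_T^3 - 441*eta_T^2*eta_x + 7623*eta_T^2*eta_y
      + 294*eta_T*eta_x^2 + 9870*eta_T*eta_y^2 + 49*eta_x^3 - 1687*eta_y^3)"
  define r3 where "r3 = R_lvl 3 - (380*w_fps*eta_T^2 - 1940*w_fps*eta_T*eta_x - 76*w_fps*eta_T*eta_y
      - 1688*w_fps*eta_x^2 + 76*w_fps*eta_y^2 - 5236*eta_T^3 - 7623*eta_T^2*eta_x + 441*eta_T^2*eta_y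
      + 9870*eta_T*eta_x^2 + 294*eta_T*eta_y^2 + 1687*eta_x^3 - 49*eta_y^3)"
  define r5 where "r5 = R_lvl 5 - (380*w_fps*eta_T^2 - 1940*w_fps*eta_T*eta_x - 76*w_fps*eta_T*eta_y
      - 1688*w_fps*eta_x^2 + 76*w_fps*eta_y^2 + 5236*eta_T^3 + 7623*eta_T^2*eta_x - 441*eta_T^2*eta_y
      - 9870*eta_T*eta_x^2 - 294*eta_T*eta_y^2 - 1687*eta_x^3 + 49*eta_y^3)"
  define r15 where "r15 = R_lvl 15 - (- 380*w_fps*eta_T^2 - 76*w_fps*eta_T*eta_x - 1940*w_fps*eta_T*eta_y
      - 76*w_fps*eta_x^2 + 1688*w_fps*eta_y^2 + 5236*eta_T^3 + 441*eta_T^2*eta_x - 7623*eta_T^2*eta_y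
      - 294*eta_T*eta_x^2 - 9870*eta_T*eta_y^2 - 49*eta_x^3 + 1687*eta_y^3)"
  \<comment> \<open>By the definitions of \<open>L_fps\<close> and \<open>w_fps\<close>, the sums
    \<open>P_lvl 1 + P_lvl 15\<close> and \<open>P_lvl 3 + P_lvl 5\<close> are exactly
    \<open>12*L_fps + 4*w_fps\<close> and \<open>12*L_fps - 4*w_fps\<close>; so the errors of
    partners are opposite.\<close>
  have P: "P_lvl 15 = 6*L_fps + 2*w_fps - 2*eta_T - eta_x + 7*eta_y - a" "P_lvl 5 = 6*L_fps - 2*w_fps
      - 2*eta_T - 7*eta_x + eta_y - b"
    unfolding a_def b_def P_lvl_eq[OF zero_less_numeral] P_lvl_eq[OF zero_less_one] L_fps_def w_fps_def
        of_nat_numeral of_nat_1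
    by algebra+
  interpret level15 L_fps w_fps eta_T eta_x eta_y a b K e1 e3 e5 e15 r1 r3 r5 r15
    "P_lvl 1" "P_lvl 3" "P_lvl 5" "P_lvl 15" "S_lvl 1" "S_lvl 3" "S_lvl 5" "S_lvl 15"
    "R_lvl 1" "R_lvl 3" "R_lvl 5" "R_lvl 15"
  proof
    show "P_lvl 5 = 6*L_fps - 2*w_fps - 2*eta_T - 7*eta_x + eta_y - b" "P_lvl 15 = 6*L_fps + 2*w_fps
        - 2*eta_T - eta_x + 7*eta_y - a"
      by (rule P)+
  qed (simp_all only: theta_eta_T theta_eta_x theta_eta_y eta_xy theta_P_lvl theta_S_lvl theta_R_lvl zero_less_numeral
      zero_less_one, simp_all add: a_def b_def K_def e1_def e3_def e5_def e15_def r1_def r3_def r5_def r15_def)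
  have P0: "fps_nth (P_lvl d) 0 = of_nat d" "fps_nth (S_lvl d) 0 = of_nat d ^ 2" "fps_nth (R_lvl d) 0 = of_nat d ^ 3"
    if "0 < d" for d
    using that by (simp_all add: P_lvl_def S_lvl_def R_lvl_def eisenstein2_def eisenstein4_def eisenstein6_def
      fps_power_zeroth sigma_fps_nth divisor_sigma_0)
  have Lw: "fps_nth L_fps 0 = 1" "fps_nth w_fps 0 = 1"
    by (simp_all add: L_fps_def w_fps_def sigma_lvl_0)
  have zero: "a = 0 \<and> b = 0 \<and> K = 0 \<and> e1 = 0 \<and> e3 = 0 \<and> e5 = 0 \<and> e15 = 0"
  proof (rule errors_eq_0)
    have "fps_nth a 1 = 0" if "sigma_lvl_list 1 1 = 1" "sigma_lvl_list 3 1 = 0" "sigma_lvl_list 5 1 = 0"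
        "sigma_lvl_list 15 1 = 0"
      unfolding a_def P_lvl_eq[OF zero_less_one] L_fps_def w_fps_def
      using eta_T_nth[of 0] eta_y_nth[of 1] that by (simp add: fps_numeral_mult_nth sigma_lvl_nth
          fps_numeral_nth eta_0[simplified])
    moreover have "sigma_lvl_list 1 1 = 1" "sigma_lvl_list 3 1 = 0" "sigma_lvl_list 5 1 = 0" "sigma_lvl_list 15 1 = 0"
      by code_simp+
    ultimately show "fps_nth a 1 = 0" .
    have "fps_nth a 15 = 0" if "sigma_lvl_list 1 15 = 24" "sigma_lvl_list 3 15 = 18" "sigma_lvl_list 5 15 = 20"
        "sigma_lvl_list 15 15 = 15"
      unfolding a_def P_lvl_eq[OF zero_less_one] L_fps_def w_fps_def
      using eta_T_nth[of 14] eta_y_nth[of 15] eta_x_nth[of 15] that by (simp add: fps_numeral_mult_nth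
          sigma_lvl_nth fps_numeral_nth)
    moreover have "sigma_lvl_list 1 15 = 24" "sigma_lvl_list 3 15 = 18" "sigma_lvl_list 5 15 = 20"
        "sigma_lvl_list 15 15 = 15"
      by code_simp+
    ultimately show "fps_nth a 15 = 0" .
    have "fps_nth b 3 = 0" if "sigma_lvl_list 1 3 = 4" "sigma_lvl_list 3 3 = 3" "sigma_lvl_list 5 3 = 0"
        "sigma_lvl_list 15 3 = 0"
      unfolding b_def P_lvl_eq[OF zero_less_numeral] L_fps_def w_fps_def
      using eta_T_nth[of 2] eta_y_nth[of 3] eta_x_nth[of 3] that by (simp add: fps_numeral_mult_nth
          sigma_lvl_nth fps_numeral_nth)
    moreover have "sigma_lvl_list 1 3 = 4" "sigma_lvl_list 3 3 = 3" "sigma_lvl_list 5 3 = 0" "sigma_lvl_list 15 3 = 0"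
      by code_simp+
    ultimately show "fps_nth b 3 = 0" .
    have "fps_nth b 5 = 0" if "sigma_lvl_list 1 5 = 6" "sigma_lvl_list 3 5 = 0" "sigma_lvl_list 5 5 = 5"
        "sigma_lvl_list 15 5 = 0"
      unfolding b_def P_lvl_eq[OF zero_less_numeral] L_fps_def w_fps_def
      using eta_T_nth[of 4] eta_y_nth[of 5] eta_x_nth[of 5] that by (simp add: fps_numeral_mult_nth
          sigma_lvl_nth fps_numeral_nth)
    moreover have "sigma_lvl_list 1 5 = 6" "sigma_lvl_list 3 5 = 0" "sigma_lvl_list 5 5 = 5" "sigma_lvl_list 15 5 = 0"
      by code_simp+
    ultimately show "fps_nth b 5 = 0" .
  qed (simp_all add: Lw eta_0 a_def b_def K_def e1_def e3_def e5_def e15_def r1_def r3_def r5_def r15_def P0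
      fps_power_zeroth)
  show "P_lvl 1 = 6*L_fps + 2*w_fps + 2*eta_T + eta_x - 7*eta_y"
    using zero P by (simp add: a_def b_def)
  show "P_lvl 3 = 6*L_fps - 2*w_fps + 2*eta_T + 7*eta_x - eta_y"
    using zero P by (simp add: a_def b_def)
  show "P_lvl 5 = 6*L_fps - 2*w_fps - 2*eta_T - 7*eta_x + eta_y"
    using zero P by (simp add: a_def b_def)
  show "P_lvl 15 = 6*L_fps + 2*w_fps - 2*eta_T - eta_x + 7*eta_y"
    using zero P by (simp add: a_def b_def)
  show "w_fps^2 = - 13*eta_T^2 + 10*eta_T*eta_x - 10*eta_T*eta_y + eta_x^2 + eta_y^2"
    using zero by (simp add: K_def)
  show "S_lvl 1 = 8*w_fps*eta_T - 8*w_fps*eta_x - 112*w_fps*eta_y - 170*eta_T^2 + 68*eta_T*eta_x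
      - 332*eta_T*eta_y + 17*eta_x^2 + 113*eta_y^2"
    using zero by (simp add: e1_def)
  show "S_lvl 3 = - 8*w_fps*eta_T - 112*w_fps*eta_x - 8*w_fps*eta_y - 170*eta_T^2 + 332*eta_T*eta_x
      - 68*eta_T*eta_y + 113*eta_x^2 + 17*eta_y^2"
    using zero by (simp add: e3_def)
  show "S_lvl 5 = 8*w_fps*eta_T + 112*w_fps*eta_x + 8*w_fps*eta_y - 170*eta_T^2 + 332*eta_T*eta_x
      - 68*eta_T*eta_y + 113*eta_x^2 + 17*eta_y^2"
    using zero by (simp add: e5_def)
  show "S_lvl 15 = - 8*w_fps*eta_T + 8*w_fps*eta_x + 112*w_fps*eta_y - 170*eta_T^2 + 68*eta_T*eta_x
      - 332*eta_T*eta_y + 17*eta_x^2 + 113*eta_y^2"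
    using zero by (simp add: e15_def)
  have "96 * theta w_fps = 96 * (L_fps*w_fps + eta_x^2 + 5*eta_T*eta_x + 5*eta_T*eta_y - eta_y^2)"
    using theta_w zero by (simp add: algebra_simps)
  then show "theta w_fps = L_fps*w_fps + eta_x^2 + 5*eta_T*eta_x + 5*eta_T*eta_y - eta_y^2"
    by (metis mult_left_cancel zero_neq_numeral)
qed

section \<open>The weight 4 cusp forms in terms of \<open>T\<close>, \<open>x\<close>,
  \<open>y\<close>, \<open>w\<close>\<close>

lemma theta_first_order_eq_0:
  fixes f l :: "'a::field_char_0 fps"
  assumes "theta f = l * f" "fps_nth l 0 = of_nat c" "fps_nth f c = 0"
  shows "f = 0"
proof -
  have "fps_nth f n = 0" for n
  proof (induction n rule: less_induct)
    case (less n)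
    \<comment> \<open>Thus a first nonzero coefficient could only sit at
      \<open>n = c\<close>.\<close>
    have "of_nat n * fps_nth f n = of_nat c * fps_nth f n"
      using fps_mult_nth_lowest[of n f l] less assms(1,2) by (metis theta_nth)
    then show ?case
      using assms(3) by auto
  qed
  then show ?thesis
    by (simp add: fps_eq_iff)
qed

text \<open>The q-series of \<open>Delta_4_5\<close>, see \<open>tau_4_5_eq\<close>.\<close>

definition eta_A :: "complex fps" where
  "eta_A = fps_X ^ 1 * (eta_lvl 1 ^ 4 * eta_lvl 5 ^ 4)"

lemma eta_lvl_compose: "0 < d \<Longrightarrow> 0 < e \<Longrightarrow> eta_lvl d oo fps_X ^ e = eta_lvl (d * e)"
  unfolding eta_lvl_def
  by (rule fps_ext) (auto simp: fps_compose_X_power_nth div_mult2_eq mult.commute[of d] dvd_div_iff_mult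
      dest: dvd_mult_left)

lemma eta_A3: "eta_A oo fps_X ^ 3 = fps_X ^ 3 * (eta_lvl 3 ^ 4 * eta_lvl 15 ^ 4)"
proof -
  have X: "fps_nth (fps_X ^ 3 :: complex fps) 0 = 0"
    by simp
  show ?thesis
    by (simp add: eta_A_def fps_compose_mult_distrib[OF X] fps_compose_power[OF X, symmetric] eta_lvl_compose)
qed

lemma sigma_lvl_eq: "0 < d \<Longrightarrow> 24 * sigma_lvl d = of_nat d - (P_lvl d :: 'a::idom fps)"
  by (simp add: P_lvl_eq)

text \<open>Both sides have the logarithmic derivative \<open>2 * L_fps - eta_x - eta_y\<close>. Its
  constant term is 1, so comparing the coefficients of q suffices.\<close>

lemma eta_A_eq: "2 * eta_A = eta_T * (- 5 * eta_T - eta_x + eta_y + w_fps)"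
proof -
  let ?f = "2 * eta_A - eta_T * (- 5 * eta_T - eta_x + eta_y + w_fps)"
  have l: "of_nat 1 + (of_nat 4 * (- sigma_lvl 1) + of_nat 4 * (- sigma_lvl 5)) = 2 * L_fps - eta_x - eta_y"
    (is "?l = ?r")
  proof -
    have "24 * ?l = 24 * ?r"
      using sigma_lvl_eq[of 1, where 'a = complex, OF zero_less_one] sigma_lvl_eq[of 5, where 'a = complex, OF
          zero_less_numeral]
      unfolding P_eta of_nat_numeral of_nat_1 by algebra
    then show ?thesis
      by (metis mult_left_cancel zero_neq_numeral)
  qed
  have "theta eta_A = ?l * eta_A"
    unfolding eta_A_def by (intro theta_log) simp_all
  note th = this[unfolded l]
  have "theta ?f = 2 * theta eta_A - theta eta_T * (- 5 * eta_T - eta_x + eta_y + w_fps)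
      - eta_T * (- 5 * theta eta_T - theta eta_x + theta eta_y + theta w_fps)"
    by (simp add: theta_simps)
  also have "\<dots> = ?r * ?f"
    unfolding th theta_eta_T theta_eta_x theta_eta_y theta_w_eta by algebra
  finally have "?f = 0"
  proof (rule theta_first_order_eq_0[where c = 1])
    have "fps_nth eta_A 1 = 1"
      by (simp add: eta_A_def eta_lvl_mult_0)
    moreover have "fps_nth (eta_T * f) 1 = fps_nth f 0" for f
      using eta_T_nth[of 0] by (simp add: fps_mult_nth eta_0)
    ultimately show "fps_nth ?f 1 = 0"
      using eta_T_nth[of 0] by (simp add: fps_numeral_mult_nth fps_numeral_nth eta_0 w_fps_def sigma_lvl_0)
  qed (simp add: fps_numeral_mult_nth eta_0 L_fps_def sigma_lvl_0)
  then show ?thesis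
    by simp
qed

text \<open>The right side is that of \<open>eta_A_eq\<close> under the substitution of
  \<open>swap_1_3\<close>, which fixes \<open>T\<close>, negates \<open>w\<close> and exchanges
  \<open>x\<close> with \<open>- y\<close>. The constant term of the logarithmic derivative is now
  3.\<close>

lemma eta_A3_eq: "18 * (eta_A oo fps_X ^ 3) = eta_T * (- 5 * eta_T - eta_x + eta_y - w_fps)"
proof -
  let ?f = "18 * (eta_A oo fps_X ^ 3) - eta_T * (- 5 * eta_T - eta_x + eta_y - w_fps)"
  have l: "of_nat 3 + (of_nat 4 * (- sigma_lvl 3) + of_nat 4 * (- sigma_lvl 15)) = 2 * L_fps + eta_x + eta_y"
    (is "?l = ?r")
  proof -
    have "24 * ?l = 24 * ?r"
      using sigma_lvl_eq[of 3, where 'a = complex, OF zero_less_numeral] sigma_lvl_eq[of 15, where 'a =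
          complex, OF zero_less_numeral]
      unfolding P_eta of_nat_numeral of_nat_1 by algebra
    then show ?thesis
      by (metis mult_left_cancel zero_neq_numeral)
  qed
  have "theta (eta_A oo fps_X ^ 3) = ?l * (eta_A oo fps_X ^ 3)"
    unfolding eta_A3 by (intro theta_log) simp_all
  note th = this[unfolded l]
  have "theta ?f = 18 * theta (eta_A oo fps_X ^ 3) - theta eta_T * (- 5 * eta_T - eta_x + eta_y - w_fps)
      - eta_T * (- 5 * theta eta_T - theta eta_x + theta eta_y - theta w_fps)"
    by (simp add: theta_simps)
  also have "\<dots> = ?r * ?f"
    unfolding th theta_eta_T theta_eta_x theta_eta_y theta_w_eta by algebra
  finally have "?f = 0"
  proof (rule theta_first_order_eq_0[where c = 3])
    have "fps_nth (eta_A oo fps_X ^ 3) 3 = 1"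
      by (simp add: eta_A3 eta_lvl_mult_0 fps_X_power_mult_nth)
    \<comment> \<open>\<open>eta_T\<close> begins X - X^2 - X^3.\<close>
    moreover have "fps_nth (eta_T * f) 3 = fps_nth f 2 - fps_nth f 1 - fps_nth f 0" for f
      using eta_T_nth[of 0] eta_T_nth[of 1] eta_T_nth[of 2]
      by (simp add: fps_mult_nth eta_0 eval_nat_numeral)
    moreover have "sigma_lvl_list 1 1 = 1" "sigma_lvl_list 3 1 = 0" "sigma_lvl_list 5 1 = 0" "sigma_lvl_list 15 1 = 0"
      "sigma_lvl_list 1 2 = 3" "sigma_lvl_list 3 2 = 0" "sigma_lvl_list 5 2 = 0" "sigma_lvl_list 15 2 = 0"
      by code_simp+
    ultimately show "fps_nth ?f 3 = 0"
      using eta_T_nth[of 0] eta_T_nth[of 1] eta_x_nth[of 2] eta_y_nth[of 1] eta_y_nth[of 2]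
      by (simp add: fps_numeral_mult_nth fps_numeral_nth eta_0[simplified] w_fps_def sigma_lvl_nth
          sigma_lvl_list_0 numeral_2_eq_2)
  qed (simp add: fps_numeral_mult_nth eta_0 L_fps_def sigma_lvl_0)
  then show ?thesis
    by simp
qed

text \<open>The q-series of \<open>Delta_4_15_1\<close>; \<open>eta_T * eta_x\<close> is its last
  eta quotient, see \<open>eta_T_x\<close>. By \<open>eta_A_eq\<close> and \<open>eta_A3_eq\<close>
  the whole form equals \<open>eta_T * (eta_x + eta_y)\<close>.\<close>

definition eta_t1 :: "complex fps" where
  "eta_t1 = eta_A + 9 * (eta_A oo fps_X ^ 3) + 5 * eta_T ^ 2 + 2 * (eta_T * eta_x)"
definition eta_t2 :: "complex fps" where
  "eta_t2 = eta_A + 9 * (eta_A oo fps_X ^ 3) + 7 * eta_T ^ 2"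

text \<open>The weights 48, 432, 260, 273 are 21840 times 1/455, 9/455, 1/84, 1/80. The differences
  of \<open>P_lvl\<close> squares and \<open>S_lvl\<close> are derivatives and produce the terms
  with \<open>n\<close> times a divisor sum.\<close>

lemma P_1_15: "364 * (P_lvl 1 * P_lvl 15) = 21 * (S_lvl 1 + S_lvl 3 + S_lvl 5 + S_lvl 15)
    + 182 * (P_lvl 1 ^ 2 - S_lvl 1) + 182 * (P_lvl 15 ^ 2 - S_lvl 15)
    - 144 * (48 * eta_A + 432 * (eta_A oo fps_X ^ 3) + 260 * eta_t2 + 273 * eta_t1)"
proof -
  have "144 * (48 * eta_A + 432 * (eta_A oo fps_X ^ 3) + 260 * eta_t2 + 273 * eta_t1)
      = 72 * 581 * (2 * eta_A) + 8 * 5229 * (18 * (eta_A oo fps_X ^ 3)) + 144 * (1820 + 1365) * eta_T ^ 2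
        + 144 * 546 * (eta_T * eta_x)"
    unfolding eta_t1_def eta_t2_def by (simp add: algebra_simps)
  then show ?thesis
    unfolding eta_A_eq eta_A3_eq P_eta S_eta using w2_eta eta_xy by algebra
qed

text \<open>The image of \<open>P_1_15\<close> under the substitution of \<open>swap_1_3\<close>: it
  exchanges \<open>eta_A\<close> with \<open>9 * (eta_A oo fps_X ^ 3)\<close>, fixes
  \<open>eta_t2\<close> and negates \<open>eta_t1\<close>.\<close>

lemma P_3_5: "364 * (P_lvl 3 * P_lvl 5) = 21 * (S_lvl 1 + S_lvl 3 + S_lvl 5 + S_lvl 15)
    + 182 * (P_lvl 3 ^ 2 - S_lvl 3) + 182 * (P_lvl 5 ^ 2 - S_lvl 5)
    - 144 * (48 * eta_A + 432 * (eta_A oo fps_X ^ 3) + 260 * eta_t2 - 273 * eta_t1)"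
proof -
  have "144 * (48 * eta_A + 432 * (eta_A oo fps_X ^ 3) + 260 * eta_t2 - 273 * eta_t1)
      = 72 * 35 * (2 * eta_A) + 8 * 315 * (18 * (eta_A oo fps_X ^ 3)) + 144 * (1820 - 1365) * eta_T ^ 2
        - 144 * 546 * (eta_T * eta_x)"
    unfolding eta_t1_def eta_t2_def by (simp add: algebra_simps)
  then show ?thesis
    unfolding eta_A_eq eta_A3_eq P_eta S_eta using w2_eta eta_xy by algebra
qed

section \<open>Expansions of the eta quotients and convolution sums\<close>

lemma norm_q_of_less_1: "0 < Im z \<Longrightarrow> norm (q_of z) < 1"
  by (simp add: q_of_def)

lemma q_of_surj:
  assumes "norm u < 1" "u \<noteq> 0"
  obtains z where "0 < Im z" "q_of z = u"
proof
  let ?z = "Ln u / (2 * of_real pi * \<i>)"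
  show "q_of ?z = u"
    using assms by (simp add: q_of_def)
  have "Im ?z = - ln (norm u) / (2 * pi)"
    using assms by (simp add: Im_divide power2_eq_square)
  then show "0 < Im ?z"
    using assms by (simp add: divide_neg_pos)
qed

lemma has_q_expansionI:
  assumes "f has_fps_expansion A" "f holomorphic_on ball 0 1" "fps_nth A 0 = 0"
    and "\<And>z. 0 < Im z \<Longrightarrow> F z = f (q_of z)"
  shows "has_q_expansion F (fps_nth A)"
  unfolding has_q_expansion_def
proof (intro conjI allI impI)
  fix z assume z: "0 < Im z"
  have "f holomorphic_on eball 0 (ereal 1)"
    using assms(2) by simp
  with norm_q_of_less_1[OF z] show "(\<lambda>n. fps_nth A n * q_of z ^ n) sums F z"
    unfolding assms(4)[OF z]
    by (intro has_fps_expansion_imp_sums_complex[OF assms(1), of "ereal 1"]) auto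
qed (rule assms(3))

lemma has_q_expansion_imp_fps_expansion:
  assumes "has_q_expansion F b" "f 0 = 0"
    and "\<And>z. 0 < Im z \<Longrightarrow> F z = f (q_of z)"
  shows "f has_fps_expansion Abs_fps b"
proof (rule has_fps_expansionI)
  have "(\<lambda>n. fps_nth (Abs_fps b) n * u ^ n) sums f u" if "norm u < 1" for u
  proof (cases "u = 0")
    case True
    have "(\<lambda>n. b n * u ^ n) = (\<lambda>n. 0)"
      using True assms(1) by (auto simp: has_q_expansion_def power_0_left)
    then show ?thesis
      using True assms(2) by simp
  next
    case False
    with that obtain z where "0 < Im z" "q_of z = u"
      by (rule q_of_surj)
    with assms(1,3) show ?thesis
      by (auto simp: has_q_expansion_def)
  qed
  then show "\<forall>\<^sub>F u in nhds 0. (\<lambda>n. fps_nth (Abs_fps b) n * u ^ n) sums f u"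
    using eventually_nhds_in_open[of "ball 0 1" "0::complex"] by (auto elim: eventually_mono)
qed

text \<open>Uniqueness, required by the definite description in \<open>q_coeff\<close>, holds
  because \<open>q_of\<close> reaches every nonzero point of the unit disc, so a q-expansion of
  \<open>F\<close> is a power series of \<open>f\<close> around 0.\<close>

lemma q_coeff_eq:
  assumes "f has_fps_expansion A" "f holomorphic_on ball 0 1" "fps_nth A 0 = 0"
    and "\<And>z. 0 < Im z \<Longrightarrow> F z = f (q_of z)"
  shows "q_coeff F = fps_nth A"
  unfolding q_coeff_def
proof (rule the_equality)
  show "has_q_expansion F (fps_nth A)"
    using assms by (rule has_q_expansionI)
  fix b assume b: "has_q_expansion F b"
  have "f 0 = 0"
    using has_fps_expansion_imp_0_eq_fps_nth_0[OF assms(1)] assms(3) by simp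
  with b have "f has_fps_expansion Abs_fps b"
    using assms(4) by (rule has_q_expansion_imp_fps_expansion)
  with assms(1) have "A = Abs_fps b"
    by (rule fps_expansion_unique_complex)
  then show "b = fps_nth A"
    by (simp add: fun_eq_iff)
qed

section \<open>Eta quotients as functions of q\<close>

lemma has_fps_expansion_euler_power:
  assumes "0 < d"
  shows "(\<lambda>q. euler_fun (q ^ d)) has_fps_expansion eta_lvl d"
proof -
  have "(euler_fun \<circ> (\<lambda>q. q ^ d)) has_fps_expansion (euler_fps oo fps_X ^ d)"
    using assms by (intro has_fps_expansion_compose has_fps_expansion_euler fps_expansion_intros) simp
  then show ?thesis
    by (simp add: eta_lvl_def o_def)
qed

lemma holomorphic_euler_power:
  assumes "0 < d"
  shows "(\<lambda>q. euler_fun (q ^ d)) holomorphic_on ball 0 1"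
proof -
  have "euler_fun \<circ> (\<lambda>q. q ^ d) holomorphic_on ball 0 1"
    using assms
    by (intro holomorphic_on_compose_gen[OF _ holomorphic_euler_fun] holomorphic_intros)
      (auto simp: norm_power power_less_one_iff)
  then show ?thesis
    by (simp add: o_def)
qed

lemma euler_fun_power_nonzero: "0 < d \<Longrightarrow> norm q < 1 \<Longrightarrow> euler_fun (q ^ d) \<noteq> 0"
  by (rule euler_fun_nonzero) (simp add: norm_power power_less_one_iff)

text \<open>One 24th root of q for all levels: the fractional powers in the eta(dz) become integer
  powers of it, and no branch has to be chosen.\<close>

definition q_root :: "complex \<Rightarrow> complex" where
  "q_root z = exp (2 * of_real pi * \<i> * z / 24)"

lemma q_root_nonzero: "q_root z \<noteq> 0"
  by (simp add: q_root_def)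

lemma q_of_eq: "q_of z = q_root z ^ 24"
  by (simp add: q_of_def q_root_def mult_ac flip: exp_of_nat_mult)

lemma dedekind_eta_mult: "dedekind_eta (of_nat d * z) = q_root z ^ d * euler_fun (q_of z ^ d)"
proof -
  have "exp (2 * of_real pi * \<i> * (of_nat d * z) / 24) = q_root z ^ d"
    by (simp add: q_root_def mult_ac flip: exp_of_nat_mult)
  moreover have "q_of (of_nat d * z) = q_of z ^ d"
    by (simp add: q_of_def mult_ac flip: exp_of_nat_mult)
  ultimately show ?thesis
    by (simp add: dedekind_eta_def euler_fun_def)
qed

lemmas dedekind_eta_1 = dedekind_eta_mult[of 1, unfolded of_nat_1 mult_1_left]
lemmas dedekind_eta_numeral = dedekind_eta_mult[of 3, unfolded of_nat_numeral]
  dedekind_eta_mult[of 5, unfolded of_nat_numeral]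
  dedekind_eta_mult[of 15, unfolded of_nat_numeral]

lemma Delta_4_5_eq: "Delta_4_5 z = q_of z ^ 1 * (euler_fun (q_of z ^ 1) ^ 4 * euler_fun (q_of z ^ 5) ^ 4)"
proof -
  have "(e ^ 1 * a) ^ 4 * (e ^ 5 * b) ^ 4 = Q ^ 1 * (a ^ 4 * b ^ 4)" if "Q = e ^ 24" for e a b Q :: complex
    unfolding that by algebra
  from this[OF q_of_eq] show ?thesis
    unfolding Delta_4_5_def dedekind_eta_numeral unfolding dedekind_eta_1 .
qed

lemma Delta_4_5_3_eq:
  "Delta_4_5 (3 * z) = q_of z ^ 3 * (euler_fun (q_of z ^ 3) ^ 4 * euler_fun (q_of z ^ 15) ^ 4)"
proof -
  have "(e ^ 3 * a) ^ 4 * (e ^ 15 * b) ^ 4 = Q ^ 3 * (a ^ 4 * b ^ 4)" if "Q = e ^ 24" for e a b Q :: complex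
    unfolding that by algebra
  note this[OF q_of_eq]
  moreover have "Delta_4_5 (3 * z) = dedekind_eta (3 * z) ^ 4 * dedekind_eta (15 * z) ^ 4"
    by (simp add: Delta_4_5_def)
  ultimately show ?thesis
    unfolding dedekind_eta_numeral by simp
qed

lemma Delta_2_15_eq: "Delta_2_15 z = q_of z ^ 1 * (euler_fun (q_of z ^ 1) * euler_fun (q_of z ^ 3)
    * euler_fun (q_of z ^ 5) * euler_fun (q_of z ^ 15))"
proof -
  have "(e ^ 1 * a) * (e ^ 3 * b) * (e ^ 5 * c) * (e ^ 15 * d) = Q ^ 1 * (a * b * c * d)"
    if "Q = e ^ 24" for e a b c d Q :: complex
    unfolding that by algebra
  from this[OF q_of_eq] show ?thesis
    unfolding Delta_2_15_def dedekind_eta_numeral unfolding dedekind_eta_1 .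
qed

lemma eta_quotient_eq:
  "dedekind_eta z ^ 5 * dedekind_eta (15 * z) ^ 5 / (dedekind_eta (3 * z) * dedekind_eta (5 * z))
    = q_of z ^ 3 * (euler_fun (q_of z ^ 1) ^ 5 * euler_fun (q_of z ^ 15) ^ 5
      * inverse (euler_fun (q_of z ^ 3) * euler_fun (q_of z ^ 5)))"
proof -
  have "(e ^ 1 * a) ^ 5 * (e ^ 15 * d) ^ 5 / ((e ^ 3 * b) * (e ^ 5 * c))
      = Q ^ 3 * (a ^ 5 * d ^ 5 * inverse (b * c))" if "e \<noteq> 0" "Q = e ^ 24" for e a b c d Q :: complex
  proof -
    \<comment> \<open>\<open>5 + 75 = 8 + 3 * 24\<close>, and \<open>e ^ 8\<close> cancels against
      the denominator.\<close>
    have 1: "(e ^ 1 * a) ^ 5 * (e ^ 15 * d) ^ 5 = e ^ 8 * (Q ^ 3 * (a ^ 5 * d ^ 5))"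
      and 2: "(e ^ 3 * b) * (e ^ 5 * c) = e ^ 8 * (b * c)"
      unfolding that by algebra+
    have "e ^ 8 * s / (e ^ 8 * t) = s * inverse t" for s t
      using that(1) by (simp add: divide_inverse)
    from this[of "Q ^ 3 * (a ^ 5 * d ^ 5)" "b * c"] show ?thesis
      unfolding 1 2 by (simp only: mult.assoc)
  qed
  from this[OF q_root_nonzero q_of_eq] show ?thesis
    unfolding dedekind_eta_numeral unfolding dedekind_eta_1 .
qed

lemma eta_T_x: "eta_T * eta_x = fps_X ^ 3 * (eta_lvl 1 ^ 5 * eta_lvl 15 ^ 5 * inverse (eta_lvl 3 * eta_lvl 5))"
proof -
  have "i * (b ^ 2 * c ^ 2) = 1 \<Longrightarrow> j * (b * c) = 1 \<Longrightarrow> b * c * i = j" for b c i j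
      :: "complex fps"
    by algebra
  from this[OF inverse_eta_lvl(1)]
  have "eta_lvl 3 * eta_lvl 5 * inverse (eta_lvl 3 ^ 2 * eta_lvl 5 ^ 2) = inverse (eta_lvl 3 * eta_lvl 5)"
    by (simp add: inverse_mult_eq_1 eta_lvl_0)
  then have "fps_X ^ 3 * (eta_lvl 1 ^ 5 * eta_lvl 15 ^ 5 * inverse (eta_lvl 3 * eta_lvl 5))
      = fps_X ^ 3 * (eta_lvl 1 ^ 5 * eta_lvl 15 ^ 5
        * (eta_lvl 3 * eta_lvl 5 * inverse (eta_lvl 3 ^ 2 * eta_lvl 5 ^ 2)))"
    by simp
  also have "\<dots> = eta_T * eta_x"
    unfolding eta_T_def eta_x_def by (simp add: power_mult_distrib eval_nat_numeral mult_ac)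
  finally show ?thesis ..
qed

lemmas eta_expansion_intros = fps_expansion_intros has_fps_expansion_euler_power
lemmas eta_holomorphic_intros = holomorphic_intros holomorphic_euler_power

lemma tau_4_5_eq: "tau_4_5 = fps_nth eta_A"
  unfolding tau_4_5_def
proof (rule q_coeff_eq)
  let ?f = "\<lambda>q. q ^ 1 * (euler_fun (q ^ 1) ^ 4 * euler_fun (q ^ 5) ^ 4)"
  show "?f has_fps_expansion eta_A"
    unfolding eta_A_def by (intro eta_expansion_intros zero_less_one zero_less_numeral)
  show "?f holomorphic_on ball 0 1"
    by (intro eta_holomorphic_intros zero_less_one zero_less_numeral)
qed (simp_all add: Delta_4_5_eq eta_A_def)

lemma
  shows tau_4_15_1_eq: "tau_4_15_1 = fps_nth eta_t1"
    and tau_4_15_2_eq: "tau_4_15_2 = fps_nth eta_t2"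
proof -
  let ?A = "\<lambda>q. q ^ 1 * (euler_fun (q ^ 1) ^ 4 * euler_fun (q ^ 5) ^ 4)"
  let ?A3 = "\<lambda>q. q ^ 3 * (euler_fun (q ^ 3) ^ 4 * euler_fun (q ^ 15) ^ 4)"
  let ?T = "\<lambda>q. q ^ 1 * (euler_fun (q ^ 1) * euler_fun (q ^ 3) * euler_fun (q ^ 5) * euler_fun (q ^ 15))"
  let ?U = "\<lambda>q. q ^ 3 * (euler_fun (q ^ 1) ^ 5 * euler_fun (q ^ 15) ^ 5
      * inverse (euler_fun (q ^ 3) * euler_fun (q ^ 5)))"
  have nz: "fps_nth (eta_lvl 3 * eta_lvl 5) 0 \<noteq> 0"
    by (simp add: eta_lvl_0)
  have "?A has_fps_expansion eta_A" "?A3 has_fps_expansion (eta_A oo fps_X ^ 3)" "?T has_fps_expansion eta_T"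
    unfolding eta_A_def[symmetric] eta_A3 eta_T_def
    unfolding eta_A_def by (intro eta_expansion_intros zero_less_one zero_less_numeral)+
  note A = this
  have U: "?U has_fps_expansion eta_T * eta_x"
    unfolding eta_T_x by (intro eta_expansion_intros zero_less_one zero_less_numeral nz)
  have comb: "(\<lambda>q. f q + 9 * f3 q + 5 * t q ^ 2 + 2 * u q) has_fps_expansion F + 9 * F3 + 5 * T ^ 2 + 2 * U"
    "(\<lambda>q. f q + 9 * f3 q + 7 * t q ^ 2) has_fps_expansion F + 9 * F3 + 7 * T ^ 2"
    if "f has_fps_expansion F" "f3 has_fps_expansion F3" "t has_fps_expansion T" "u has_fps_expansion U"
    for f f3 t u :: "complex \<Rightarrow> complex" and F F3 T U
    by (intro fps_expansion_intros that)+
  from comb[OF A U] have exps: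
    "(\<lambda>q. ?A q + 9 * ?A3 q + 5 * ?T q ^ 2 + 2 * ?U q) has_fps_expansion eta_t1"
    "(\<lambda>q. ?A q + 9 * ?A3 q + 7 * ?T q ^ 2) has_fps_expansion eta_t2"
    unfolding eta_t1_def eta_t2_def .
  have hol: "(\<lambda>q. ?A q + 9 * ?A3 q + 5 * ?T q ^ 2 + 2 * ?U q) holomorphic_on ball 0 1"
    "(\<lambda>q. ?A q + 9 * ?A3 q + 7 * ?T q ^ 2) holomorphic_on ball 0 1"
    by (intro eta_holomorphic_intros zero_less_one zero_less_numeral; simp add: euler_fun_power_nonzero)+
  have zero: "fps_nth eta_t1 0 = 0" "fps_nth eta_t2 0 = 0"
    by (simp_all add: eta_t1_def eta_t2_def eta_A_def eta_0 fps_power_zeroth)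
  have Delta: "Delta_4_15_1 z = ?A (q_of z) + 9 * ?A3 (q_of z) + 5 * ?T (q_of z) ^ 2 + 2 * ?U (q_of z)"
    "Delta_4_15_2 z = ?A (q_of z) + 9 * ?A3 (q_of z) + 7 * ?T (q_of z) ^ 2" for z
    unfolding Delta_4_15_1_def Delta_4_15_2_def Delta_4_5_3_eq Delta_2_15_eq eta_quotient_eq
    unfolding Delta_4_5_eq by (rule refl)+
  show "tau_4_15_1 = fps_nth eta_t1"
    unfolding tau_4_15_1_def by (rule q_coeff_eq[OF exps(1) hol(1) zero(1) Delta(1)])
  show "tau_4_15_2 = fps_nth eta_t2"
    unfolding tau_4_15_2_def by (rule q_coeff_eq[OF exps(2) hol(2) zero(2) Delta(2)])
qed

section \<open>Convolution sums as coefficients\<close>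

lemma W2_eq_fps:
  assumes "0 < a" "0 < b"
  shows "fps_nth ((sigma_fps 1 oo fps_X ^ a) * (sigma_fps 1 oo fps_X ^ b)) n = (of_nat (W2 a b n) :: 'a::comm_ring_1)"
proof -
  \<comment> \<open>The ends \<open>i = 0\<close> and \<open>i = n\<close> contribute nothing since
    \<open>divisor_sigma 1 0 = 0\<close>; this matches the positivity of both indices in
    \<open>W2\<close>.\<close>
  let ?I = "{i\<in>{0..n}. a dvd i \<and> b dvd n - i \<and> 0 < i \<and> i < n}"
  have "fps_nth ((sigma_fps 1 oo fps_X ^ a) * (sigma_fps 1 oo fps_X ^ b)) n
      = (\<Sum>i\<in>?I. of_nat (divisor_sigma 1 (i div a) * divisor_sigma 1 ((n - i) div b)) :: 'a)"
    unfolding fps_mult_nth fps_compose_X_power_nth[OF assms(1)] fps_compose_X_power_nth[OF assms(2)]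
  proof (rule sum.mono_neutral_cong_right)
    show "\<forall>i\<in>{0..n} - ?I. (if a dvd i then fps_nth (sigma_fps 1) (i div a) else 0)
        * (if b dvd n - i then fps_nth (sigma_fps 1) ((n - i) div b) else 0) = (0 :: 'a)"
    proof
      fix i assume "i \<in> {0..n} - ?I"
      then consider "i = 0" | "i = n" | "\<not> a dvd i" | "\<not> b dvd n - i"
        by fastforce
      then show "(if a dvd i then fps_nth (sigma_fps 1) (i div a) else 0)
          * (if b dvd n - i then fps_nth (sigma_fps 1) ((n - i) div b) else 0) = (0 :: 'a)"
        by cases (simp_all add: sigma_fps_nth divisor_sigma_0)
    qed
  qed (auto simp: sigma_fps_nth)
  also have "\<dots> = (\<Sum>(l, m) | 0 < l \<and> 0 < m \<and> a * l
      + b * m = n. of_nat (divisor_sigma 1 l * divisor_sigma 1 m))"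
    using assms
    by (intro sum.reindex_bij_witness[where j = "\<lambda>i. (i div a, (n
        - i) div b)" and i = "\<lambda>(l, m). a * l"])
      (auto simp: dvd_div_pos)
  finally show ?thesis
    by (simp add: W2_def case_prod_unfold)
qed

lemma W1_eq_W2: "0 < N \<Longrightarrow> W1 N n = W2 1 N n"
  unfolding W1_def W2_def
  by (rule sum.reindex_bij_witness[where j = "\<lambda>m. (n - N * m, m)" and i = "\<lambda>(l, m). m"])
    (auto simp: field_simps mult.commute simp flip: of_nat_mult)

lemma W2_sigma_lvl:
  assumes "0 < a" "0 < b"
  shows "fps_nth (sigma_lvl a * sigma_lvl b) n = (of_nat (a * b * W2 a b n) :: 'a::comm_ring_1)"
proof -
  have "sigma_lvl a * sigma_lvl b
      = fps_const (of_nat (a * b)) * ((sigma_fps 1 oo fps_X ^ a) * (sigma_fps 1 oo fps_X ^ b) :: 'a fps)"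
    unfolding sigma_lvl_def fps_of_nat unfolding of_nat_mult by (simp only: mult_ac)
  then show ?thesis
    by (simp only: fps_mult_left_const_nth W2_eq_fps[OF assms] of_nat_mult)
qed

lemma at_quot_fps: "0 < k \<Longrightarrow> at_quot (fps_nth f) n k = fps_nth (f oo fps_X ^ k) n" for f ::
    "'a::comm_ring_1 fps"
  by (simp add: at_quot_def fps_compose_X_power_nth)

lemma sigma_lvl_nth_at_quot:
  "0 < d \<Longrightarrow> fps_nth (sigma_lvl d) n = (of_nat d * of_nat (at_quot (divisor_sigma 1) n d) ::
      'a::comm_ring_1)"
  by (simp add: sigma_lvl_def at_quot_def fps_compose_X_power_nth sigma_fps_nth flip: fps_of_nat)

lemma sigma_3_nth_at_quot:
  "0 < d \<Longrightarrow> fps_nth (sigma_fps 3 oo fps_X ^ d) n = (of_nat (at_quot (divisor_sigma 3) n d) ::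
      'a::comm_ring_1)"
  by (simp add: at_quot_def fps_compose_X_power_nth sigma_fps_nth)

lemma S_lvl_eq: "0 < d \<Longrightarrow> S_lvl d = of_nat d ^ 2 * (1
    + 240 * (sigma_fps 3 oo fps_X ^ d) :: 'a::idom fps)"
  by (simp add: S_lvl_def eisenstein4_def fps_compose_add_distrib fps_compose_mult_distrib fps_compose_numeral)

lemma theta_sigma_lvl: "0 < d \<Longrightarrow> P_lvl d ^ 2 - S_lvl d =
    - 288 * (theta (sigma_lvl d) :: 'a::field_char_0 fps)"
  unfolding theta_P_lvl[symmetric] by (simp add: P_lvl_eq theta_simps)

lemma P_product_coefficients:
  assumes ab: "0 < a" "0 < b" "a * b = 15"
    and prod: "364 * (P_lvl a * P_lvl b) = 21 * (S_lvl 1 + S_lvl 3 + S_lvl 5 + S_lvl 15)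
      + 182 * (P_lvl a ^ 2 - S_lvl a) + 182 * (P_lvl b ^ 2 - S_lvl b) - 144 * (F :: complex fps)"
  shows "(of_nat (W2 a b n) :: complex) =
      1 / 624 * of_nat (divisor_sigma 3 n) + 3 / 208 * of_nat (at_quot (divisor_sigma 3) n 3)
    + 25 / 624 * of_nat (at_quot (divisor_sigma 3) n 5) + 75 / 208 * of_nat (at_quot (divisor_sigma 3) n 15)
    + (1 / 24 - of_nat a * of_nat n / 60) * of_nat (at_quot (divisor_sigma 1) n a)
    + (1 / 24 - of_nat b * of_nat n / 60) * of_nat (at_quot (divisor_sigma 1) n b)
    - 1 / 21840 * fps_nth F n"
proof -
  have "of_nat a * of_nat b = (15 :: complex fps)"
    using ab(3) by (metis of_nat_mult of_nat_numeral)
  \<comment> \<open>Expansion of the product with \<open>209664 = 364 * 24^2\<close>. The constant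
    terms cancel: \<open>364 * 15 = 21 * (1 + 9 + 25 + 225)\<close>.\<close>
  moreover have "209664 * (s * t) = 8736 * (B * s + A * t) + 5040 * (g1 + 9 * g3 + 25 * g5 + 225 * g15)
      - 52416 * (s' + t') - 144 * F"
    if "A * B = 15" "364 * ((A - 24 * s) * (B - 24 * t)) = 21 * (1 ^ 2 * (1 + 240 * g1) + 3 ^ 2 * (1 + 240 * g3)
        + 5 ^ 2 * (1 + 240 * g5) + 15 ^ 2 * (1 + 240 * g15)) + 182 * (- 288 * s') + 182 * (- 288 * t') - 144 * F"
    for A B s t s' t' g1 g3 g5 g15 :: "complex fps"
  proof -
    have "209664 * (s * t) = 364 * ((A - 24 * s) * (B - 24 * t)) - 364 * (A * B) + 8736 * (B * s + A * t)"
      by algebra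
    then show ?thesis
      unfolding that by (simp add: algebra_simps)
  qed
  ultimately have eq: "209664 * (sigma_lvl a * sigma_lvl b) = 8736 * (of_nat b * sigma_lvl a + of_nat a * sigma_lvl b)
      + 5040 * ((sigma_fps 3 oo fps_X ^ 1) + 9 * (sigma_fps 3 oo fps_X ^ 3) + 25 * (sigma_fps 3 oo fps_X ^ 5)
        + 225 * (sigma_fps 3 oo fps_X ^ 15))
      - 52416 * (theta (sigma_lvl a) + theta (sigma_lvl b)) - 144 * F"
    using prod[unfolded theta_sigma_lvl[OF ab(1)] theta_sigma_lvl[OF ab(2)], unfolded P_lvl_eq[OF ab(1)]
        P_lvl_eq[OF ab(2)]
      S_lvl_eq[OF zero_less_one] S_lvl_eq[OF zero_less_numeral] of_nat_1 of_nat_numeral] by blast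
  have quot_1: "at_quot (divisor_sigma 3) n 1 = divisor_sigma 3 n"
    by (simp add: at_quot_def)
  have W: "209664 * of_nat (15 * W2 a b n) = 8736 * (of_nat b * (of_nat a * of_nat (at_quot (divisor_sigma 1) n a))
        + of_nat a * (of_nat b * of_nat (at_quot (divisor_sigma 1) n b)))
      + 5040 * (of_nat (divisor_sigma 3 n) + 9 * of_nat (at_quot (divisor_sigma 3) n 3)
        + 25 * of_nat (at_quot (divisor_sigma 3) n 5) + 225 * of_nat (at_quot (divisor_sigma 3) n 15))
      - 52416 * (of_nat n * (of_nat a * of_nat (at_quot (divisor_sigma 1) n a))
        + of_nat n * (of_nat b * of_nat (at_quot (divisor_sigma 1) n b))) - 144 * fps_nth F n"
    using arg_cong[OF eq, of "\<lambda>f. fps_nth f n"]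
    unfolding fps_add_nth fps_sub_nth fps_numeral_mult_nth W2_sigma_lvl[OF ab(1,2)] ab(3) theta_nth
      sigma_lvl_nth_at_quot[OF ab(1)] sigma_lvl_nth_at_quot[OF ab(2)] sigma_3_nth_at_quot[OF zero_less_one]
      sigma_3_nth_at_quot[OF zero_less_numeral] quot_1 fps_of_nat[symmetric] fps_mult_left_const_nth .
  have ab_15: "of_nat b * (of_nat a * s) + of_nat a * (of_nat b * t) = 15 * (s + t)" for s t :: complex
  proof -
    have "of_nat a * of_nat b = (15 :: complex)"
      using ab(3) by (metis of_nat_mult of_nat_numeral)
    moreover have "of_nat b * (of_nat a * s) + of_nat a * (of_nat b * t) = of_nat a * of_nat b * (s + t)"
      by (simp only: algebra_simps)
    ultimately show ?thesis
      by (simp only:)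
  qed
  \<comment> \<open>\<open>3144960 = 15 * 209664\<close>, which turns the factor 144 of
    \<open>F\<close> into 1/21840.\<close>
  from W[unfolded ab_15] have "of_nat (W2 a b n) = (8736 * (15 * (of_nat (at_quot (divisor_sigma 1) n a)
      + of_nat (at_quot (divisor_sigma 1) n b)))
      + 5040 * (of_nat (divisor_sigma 3 n) + 9 * of_nat (at_quot (divisor_sigma 3) n 3)
        + 25 * of_nat (at_quot (divisor_sigma 3) n 5) + 225 * of_nat (at_quot (divisor_sigma 3) n 15))
      - 52416 * (of_nat n * (of_nat a * of_nat (at_quot (divisor_sigma 1) n a))
        + of_nat n * (of_nat b * of_nat (at_quot (divisor_sigma 1) n b))) - 144 * fps_nth F n) / 3144960"
    by (simp add: field_simps)
  also have "\<dots> = 1 / 624 * of_nat (divisor_sigma 3 n) + 3 / 208 * of_nat (at_quot (divisor_sigma 3) n 3)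
    + 25 / 624 * of_nat (at_quot (divisor_sigma 3) n 5) + 75 / 208 * of_nat (at_quot (divisor_sigma 3) n 15)
    + (1 / 24 - of_nat a * of_nat n / 60) * of_nat (at_quot (divisor_sigma 1) n a)
    + (1 / 24 - of_nat b * of_nat n / 60) * of_nat (at_quot (divisor_sigma 1) n b)
    - 1 / 21840 * fps_nth F n"
    by (simp add: field_simps)
  finally show ?thesis .
qed

theorem theorem2p2:
  fixes n :: nat
  assumes "0 < n"
  shows
    "(of_nat (W1 15 n) :: complex) =
        1 / 624 * of_nat (divisor_sigma 3 n) + 3 / 208 * of_nat (at_quot (divisor_sigma 3) n 3)
      + 25 / 624 * of_nat (at_quot (divisor_sigma 3) n 5) + 75 / 208 * of_nat (at_quot (divisor_sigma 3) n 15)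
      + (5 - 2 * of_nat n) / 120 * of_nat (divisor_sigma 1 n)
      + (1 - 6 * of_nat n) / 24 * of_nat (at_quot (divisor_sigma 1) n 15)
      - 1 / 455 * tau_4_5 n - 9 / 455 * at_quot tau_4_5 n 3
      - 1 / 84 * tau_4_15_2 n - 1 / 80 * tau_4_15_1 n
     \<and>
     (of_nat (W2 3 5 n) :: complex) =
        1 / 624 * of_nat (divisor_sigma 3 n) + 3 / 208 * of_nat (at_quot (divisor_sigma 3) n 3)
      + 25 / 624 * of_nat (at_quot (divisor_sigma 3) n 5) + 75 / 208 * of_nat (at_quot (divisor_sigma 3) n 15)
      + (5 - 6 * of_nat n) / 120 * of_nat (at_quot (divisor_sigma 1) n 3)
      + (1 - 2 * of_nat n) / 24 * of_nat (at_quot (divisor_sigma 1) n 5)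
      - 1 / 455 * tau_4_5 n - 9 / 455 * at_quot tau_4_5 n 3
      - 1 / 84 * tau_4_15_2 n + 1 / 80 * tau_4_15_1 n"
    (is "_ = ?rhs1 \<and> _ = ?rhs2")
proof -
  have F1: "fps_nth (48 * eta_A + 432 * (eta_A oo fps_X ^ 3) + 260 * eta_t2 + 273 * eta_t1) n
      = 48 * tau_4_5 n + 432 * at_quot tau_4_5 n 3 + 260 * tau_4_15_2 n + 273 * tau_4_15_1 n"
    and F2: "fps_nth (48 * eta_A + 432 * (eta_A oo fps_X ^ 3) + 260 * eta_t2 - 273 * eta_t1) n
      = 48 * tau_4_5 n + 432 * at_quot tau_4_5 n 3 + 260 * tau_4_15_2 n - 273 * tau_4_15_1 n"
    unfolding fps_add_nth fps_sub_nth fps_numeral_mult_nth tau_4_5_eq tau_4_15_1_eq tau_4_15_2_eq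
      at_quot_fps[OF zero_less_numeral] by (rule refl)+
  have quot_1: "at_quot (divisor_sigma 1) n 1 = divisor_sigma 1 n"
    by (simp add: at_quot_def)
  show ?thesis
  proof
    have "of_nat (W1 15 n) = (1 / 624 * of_nat (divisor_sigma 3 n) + 3 / 208 * of_nat (at_quot (divisor_sigma 3) n 3)
        + 25 / 624 * of_nat (at_quot (divisor_sigma 3) n 5) + 75 / 208 * of_nat (at_quot (divisor_sigma 3) n 15)
        + (1 / 24 - of_nat 1 * of_nat n / 60) * of_nat (divisor_sigma 1 n)
        + (1 / 24 - of_nat 15 * of_nat n / 60) * of_nat (at_quot (divisor_sigma 1) n 15)
        - 1 / 21840 * (48 * tau_4_5 n + 432 * at_quot tau_4_5 n 3 + 260 * tau_4_15_2 n
            + 273 * tau_4_15_1 n) :: complex)"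
      using P_product_coefficients[OF _ _ _ P_1_15, of n]
      unfolding W1_eq_W2[OF zero_less_numeral] F1 quot_1 by simp
    also have "\<dots> = ?rhs1"
      by (simp add: field_simps)
    finally show "of_nat (W1 15 n) = ?rhs1" .
    have "of_nat (W2 3 5 n) = (1 / 624 * of_nat (divisor_sigma 3 n) + 3 / 208 * of_nat (at_quot (divisor_sigma 3) n 3)
        + 25 / 624 * of_nat (at_quot (divisor_sigma 3) n 5) + 75 / 208 * of_nat (at_quot (divisor_sigma 3) n 15)
        + (1 / 24 - of_nat 3 * of_nat n / 60) * of_nat (at_quot (divisor_sigma 1) n 3)
        + (1 / 24 - of_nat 5 * of_nat n / 60) * of_nat (at_quot (divisor_sigma 1) n 5)
        - 1 / 21840 * (48 * tau_4_5 n + 432 * at_quot tau_4_5 n 3 + 260 * tau_4_15_2 n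
            - 273 * tau_4_15_1 n) :: complex)"
      using P_product_coefficients[OF _ _ _ P_3_5, of n]
      unfolding F2 by simp
    also have "\<dots> = ?rhs2"
      by (simp add: field_simps)
    finally show "of_nat (W2 3 5 n) = ?rhs2" .
  qed
qed

end
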